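(* Let $B^{(n)}$, $Q^{(n)}$, $J$ be associated with $(\mu,\vec w,\vec n)$ as in the context. Assume that $J$ is nonnegative; that $b(B)<\infty$, $b(B)\notin\mathscr Z(B)$; that $b(Q)<\infty$, $b(Q)\notin\mathscr Z(Q)$; and that $\lim_{x\to+\infty}Q^{(n)}(x)=+\infty$ for all $n$. Let $\lambda\in I$, $\lambda\ge\max(b(B),b(Q))$, and consider the two dual Markov chains on $\mathbb N_0$ with stochastic matrices $P_{II}=\frac1\lambda\sigma_{II}J\sigma_{II}^{-1}$ and $P_I=\frac1\lambda\sigma_IJ^\top\sigma_I^{-1}$, where $\sigma_{II}=\operatorname{diag}(1/B^{(n)}(\lambda))_{n\ge0}$, $\sigma_I=\operatorname{diag}(1/Q^{(n)}(\lambda))_{n\ge0}$; assume these chains are irreducible. Then both dual Markov chains are recurrent if and only if the integral $$\int_\Delta\frac{w_1(x)}{1-\frac x\lambda}\,d\mu(x)$$ diverges. Both dual Markov chains are transient whenever the integral converges.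
   Context: General setting. $\Delta\subset\mathbb R$ is an interval, $\mu$ is a finite Borel measure of constant sign on $\Delta$ whose support has infinitely many points, $w_1,\dots,w_p$ are weights on $\Delta$ (real integrable functions, each of constant sign), all the moments $\int_\Delta x^k w_a\,d\mu$ being finite, and $\vec n=(n_1,\dots,n_p)$ is a vector of positive integers, $|\vec n|=n_1+\dots+n_p$. Every $i\in\mathbb N_0$ is written uniquely as $i=q(i)|\vec n|+n_1+\dots+n_{a(i)-1}+r(i)$ with $q(i)\in\mathbb N_0$, $a(i)\in\{1,\dots,p\}$, $0\le r(i)<n_{a(i)}$; put $k(i)=q(i)n_{a(i)}+r(i)$ and $\xi^{(i)}(x)=x^{k(i)}w_{a(i)}(x)$. The pair $(\mu,\vec w)$ is assumed perfect; in particular all leading principal minors of the moment matrix $g_{i,j}=\int_\Delta x^i\xi^{(j)}(x)\,d\mu(x)$ are nonzero. Then: - $B^{(l)}$ is the unique monic polynomial of degree $l$ with $\int_\Delta B^{(l)}\xi^{(j)}\,d\mu=0$ for $0\le j<l$; - $Q^{(l)}$ (type I linear form) is the unique real linear combination of $\xi^{(0)},\dots,\xi^{(l)}$ with $\int_\Delta x^iQ^{(l)}(x)\,d\mu(x)=\delta_{i,l}$ for $0\le i\le l$ (in particular $Q^{(0)}=w_1/\int_\Delta w_1\,d\mu$); - the Jacobi matrix $J=(J_{n,m})_{n,m\in\mathbb N_0}$ is defined by $xB^{(n)}(x)=\sum_m J_{n,m}B^{(m)}(x)$. With $N:=\max_a(|\vec n|-n_a+1)$ one has $J_{n,n+1}=1$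 and $J_{n,m}=0$ unless $n-N\le m\le n+1$. In order to evaluate $Q^{(n)}$ outside $\Delta$, the weights $w_a$ are understood to be given by continuous real functions on an interval $I\subset\mathbb R$ that is unbounded above and contains the interior of $\Delta$. $\mathscr Z(B)\subset\mathbb C$ (resp. $\mathscr Z(Q)\subset I$) is the union over $n$ of the sets of zeros of $B^{(n)}$ (resp. $Q^{(n)}$), and $b(B)$, $b(Q)$ are the suprema of the absolute values of their elements. Under the assumptions $P_{II}$ and $P_I$ are stochastic matrices. The integral is that of $1/(1-x/\lambda)$ against the measure of constant sign $w_1\,d\mu$; if this measure has an atom at $\lambda$ the integral is regarded as divergent. A state of a Markov chain is recurrent if, starting from it, the chain returns to it with probability $1$, and transient otherwise; a chain is recurrent (transient) if all its states are. *)

theory Defs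
  imports "HOL-Probability.Probability" "HOL-Computational_Algebra.Polynomial"
begin

section \<open>Markov chains on the natural numbers\<close>

definition stochastic :: "(nat \<Rightarrow> nat \<Rightarrow> real) \<Rightarrow> bool" where
  "stochastic P \<longleftrightarrow> (\<forall>i j. 0 \<le> P i j) \<and> (\<forall>i. P i sums 1)"

abbreviation path_space :: "(nat \<Rightarrow> nat) measure" where
  "path_space \<equiv> PiM UNIV (\<lambda>_. count_space UNIV)"

definition is_chain_law :: "(nat \<Rightarrow> nat \<Rightarrow> real) \<Rightarrow> nat \<Rightarrow> (nat \<Rightarrow> nat) measure \<Rightarrow> bool" where
  "is_chain_law P i L \<longleftrightarrow> prob_space L \<and> sets L = sets path_space \<and>
     (\<forall>n x. measure L {\<omega> \<in> space L. \<forall>k\<le>n. \<omega> k = x k} =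
        (if x 0 = i then \<Prod>k<n. P (x k) (x (Suc k)) else 0))"

text \<open>The law of the chain with transition matrix \<open>P\<close> started in \<open>i\<close>. For stochastic \<open>P\<close>
  it exists and is unique, see \<open>ex1_chain_law\<close> below.\<close>

definition chain_law :: "(nat \<Rightarrow> nat \<Rightarrow> real) \<Rightarrow> nat \<Rightarrow> (nat \<Rightarrow> nat) measure" where
  "chain_law P i = (THE L. is_chain_law P i L)"

definition irreducible_chain :: "(nat \<Rightarrow> nat \<Rightarrow> real) \<Rightarrow> bool" where
  "irreducible_chain P \<longleftrightarrow>
     (\<forall>i j. \<exists>n. 0 < measure (chain_law P i) {\<omega> \<in> space (chain_law P i). \<omega> n = j})"

definition recurrent_state :: "(nat \<Rightarrow> nat \<Rightarrow> real) \<Rightarrow> nat \<Rightarrow> bool" where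
  "recurrent_state P i \<longleftrightarrow>
     measure (chain_law P i) {\<omega> \<in> space (chain_law P i). \<exists>n\<ge>1. \<omega> n = i} = 1"

definition transient_state :: "(nat \<Rightarrow> nat \<Rightarrow> real) \<Rightarrow> nat \<Rightarrow> bool" where
  "transient_state P i \<longleftrightarrow> \<not> recurrent_state P i"

definition recurrent_chain :: "(nat \<Rightarrow> nat \<Rightarrow> real) \<Rightarrow> bool" where
  "recurrent_chain P \<longleftrightarrow> (\<forall>i. recurrent_state P i)"

definition transient_chain :: "(nat \<Rightarrow> nat \<Rightarrow> real) \<Rightarrow> bool" where
  "transient_chain P \<longleftrightarrow> (\<forall>i. transient_state P i)"

lemma space_path_space: "space path_space = UNIV"
  by (simp add: space_PiM)

lemma chain_law_unique:
  assumes L: "is_chain_law P i L" and K: "is_chain_law P i K"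
  shows "L = K"
proof -
  interpret L: prob_space L using L by (simp add: is_chain_law_def)
  interpret K: prob_space K using K by (simp add: is_chain_law_def)
  have sL[measurable_cong]: "sets L = sets path_space" and sK[measurable_cong]: "sets K = sets path_space"
    using L K by (simp_all add: is_chain_law_def)
  have spL: "space L = UNIV" and spK: "space K = UNIV"
    using sets_eq_imp_space_eq[OF sL] sets_eq_imp_space_eq[OF sK] by (simp_all add: space_path_space)
  define pre where "pre n \<omega> = map \<omega> [0..<Suc n]" for n and \<omega> :: "nat \<Rightarrow> nat"
  have cyl: "pre n -` {l} = (if length l = Suc n then {\<omega>. \<forall>k\<le>n. \<omega> k = l ! k} else {})" for n l
  proof -
    have "pre n \<omega> = l \<longleftrightarrow> length l = Suc n \<and> (\<forall>k\<le>n. \<omega> k = l ! k)" for \<omega>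
      unfolding pre_def list_eq_iff_nth_eq[of "map \<omega> [0..<Suc n]"]
      by (metis add_0 diff_zero length_map length_upt less_Suc_eq_le nth_map_upt)
    then show ?thesis by auto
  qed
  have cyl_sets: "{\<omega>. \<forall>k\<le>n. \<omega> k = x k} \<in> sets path_space" for n and x :: "nat \<Rightarrow> nat"
  proof -
    have "{\<omega> \<in> space path_space. \<forall>k\<le>n. \<omega> k = x k} \<in> sets path_space"
      by measurable
    then show ?thesis by (simp add: space_path_space)
  qed
  have pre_meas: "pre n \<in> measurable path_space (count_space UNIV)" for n
    by (subst measurable_count_space_eq2_countable)
       (auto simp: space_path_space cyl intro: cyl_sets)
  have pre_eq: "distr L (count_space UNIV) (pre n) = distr K (count_space UNIV) (pre n)" for n
  proof (rule measure_eqI_countable[where A = UNIV])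
    fix l :: "nat list"
    have mL: "pre n \<in> measurable L (count_space UNIV)" and mK: "pre n \<in> measurable K (count_space UNIV)"
      using pre_meas[of n] measurable_cong_sets[OF sL refl] measurable_cong_sets[OF sK refl] by auto
    have "measure L {\<omega>. \<forall>k\<le>n. \<omega> k = l ! k} = measure K {\<omega>. \<forall>k\<le>n. \<omega> k = l ! k}"
      using L K by (simp add: is_chain_law_def spL spK)
    then show "emeasure (distr L (count_space UNIV) (pre n)) {l} =
        emeasure (distr K (count_space UNIV) (pre n)) {l}"
      by (simp add: emeasure_distr[OF mL] emeasure_distr[OF mK] spL spK cyl
          L.emeasure_eq_measure K.emeasure_eq_measure)
  qed auto
  show "L = K"
  proof (rule measure_eqI_PiM_infinite[OF sL sK])
    show "finite_measure L" by (rule L.finite_measure_axioms)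
    fix A J assume J: "finite (J :: nat set)"
    define n where "n = Max (insert 0 J)"
    have n: "j \<le> n" if "j \<in> J" for j using J that by (simp add: n_def)
    have nth: "pre n \<omega> ! j = \<omega> j" if "j \<in> J" for \<omega> j
      using n[OF that] by (simp add: pre_def less_Suc_eq_le del: upt_Suc)
    have emb: "prod_emb UNIV (\<lambda>_. count_space UNIV) J (Pi\<^sub>E J A)
        = pre n -` {l. \<forall>j\<in>J. l ! j \<in> A j}"
      by (auto simp: prod_emb_def space_PiM PiE_iff nth)
    have mL: "pre n \<in> measurable L (count_space UNIV)" and mK: "pre n \<in> measurable K (count_space UNIV)"
      using pre_meas[of n] measurable_cong_sets[OF sL refl] measurable_cong_sets[OF sK refl] by auto
    show "emeasure L (prod_emb UNIV (\<lambda>_. count_space UNIV) J (Pi\<^sub>E J A)) =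
        emeasure K (prod_emb UNIV (\<lambda>_. count_space UNIV) J (Pi\<^sub>E J A))"
      using arg_cong[OF pre_eq[of n], of "\<lambda>M. emeasure M {l. \<forall>j\<in>J. l ! j \<in> A j}"]
      by (simp add: emb emeasure_distr[OF mL] emeasure_distr[OF mK] spL spK)
  qed
qed

lemma chain_law_exists:
  assumes P: "stochastic P"
  shows "\<exists>L. is_chain_law P i L"
proof -
  define p where "p i = embed_pmf (P i)" for i
  have pmf_p: "pmf (p i) j = P i j" for i j
    unfolding p_def
  proof (rule pmf_embed_pmf)
    show "(\<integral>\<^sup>+ x. ennreal (P i x) \<partial>count_space UNIV) = 1"
      using P by (auto simp: stochastic_def nn_integral_count_space_nat suminf_ennreal_eq[where x=1] dest: sums_unique[symmetric])
  qed (use P in \<open>auto simp: stochastic_def\<close>)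
  define \<Omega> where "\<Omega> = PiM UNIV (\<lambda>(k::nat, j). measure_pmf (p j))"
  interpret \<Omega>: product_prob_space "\<lambda>(k::nat, j). measure_pmf (p j)" UNIV
    by (rule product_prob_spaceI) (auto intro: measure_pmf.prob_space_axioms split: prod.splits)
  interpret O: prob_space \<Omega> unfolding \<Omega>_def by (rule \<Omega>.prob_space_axioms)
  define X where "X \<omega> = rec_nat i (\<lambda>k s. \<omega> (k, s))" for \<omega> :: "nat \<times> nat \<Rightarrow> nat"
  have X0: "X \<omega> 0 = i" and XS: "X \<omega> (Suc k) = \<omega> (k, X \<omega> k)" for \<omega> k
    by (simp_all add: X_def)
  have sp: "space \<Omega> = UNIV"
    by (auto simp: \<Omega>_def space_PiM split: prod.splits)
  have comp: "(\<lambda>\<omega>. \<omega> kj) \<in> measurable \<Omega> (count_space UNIV)" for kj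
    unfolding \<Omega>_def
    using measurable_component_singleton[of kj UNIV "\<lambda>(k::nat, j). measure_pmf (p j)"]
    by (cases kj) (simp add: measurable_def)
  have Xk: "(\<lambda>\<omega>. X \<omega> k) \<in> measurable \<Omega> (count_space UNIV)" for k
  proof (induction k)
    case (Suc k)
    show ?case unfolding XS
      by (rule measurable_compose_countable[OF comp Suc])
  qed (simp add: X0)
  have XM: "X \<in> measurable \<Omega> path_space"
    by (rule measurable_PiM_single') (use Xk in \<open>auto simp: space_PiM\<close>)
  have "is_chain_law P i (distr \<Omega> path_space X)"
    unfolding is_chain_law_def
  proof (intro conjI allI)
    show "prob_space (distr \<Omega> path_space X)" by (rule O.prob_space_distr[OF XM])
    fix n and x :: "nat \<Rightarrow> nat"
    have "{\<omega> \<in> space path_space. \<forall>k\<le>n. \<omega> k = x k} \<in> sets path_space"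
      by measurable
    then have c: "{\<omega>. \<forall>k\<le>n. \<omega> k = x k} \<in> sets path_space"
      by (simp add: space_path_space)
    have eq: "{\<omega>. \<forall>k\<le>n. X \<omega> k = x k} =
        (if x 0 = i then {\<omega>. \<forall>k<n. \<omega> (k, x k) = x (Suc k)} else {})"
    proof -
      have "(\<forall>k\<le>n. X \<omega> k = x k) \<longleftrightarrow> x 0 = i \<and> (\<forall>k<n. \<omega> (k, x k) = x (Suc k))" for \<omega>
      proof (induction n)
        case (Suc n)
        have "(\<forall>k\<le>Suc n. X \<omega> k = x k) \<longleftrightarrow> (\<forall>k\<le>n. X \<omega> k = x k) \<and> \<omega> (n, x n) = x (Suc n)"
          by (metis XS le_Suc_eq order_refl)
        then show ?case using Suc by (auto simp: less_Suc_eq)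
      qed (auto simp: X0)
      then show ?thesis by auto
    qed
    define I where "I = (\<lambda>k. (k, x k)) ` {..<n}"
    have cyl: "{\<omega>. \<forall>k<n. \<omega> (k, x k) = x (Suc k)} =
       prod_emb UNIV (\<lambda>(k::nat, j). measure_pmf (p j)) I (Pi\<^sub>E I (\<lambda>kj. {x (Suc (fst kj))}))"
      by (auto simp: prod_emb_def space_PiM PiE_iff I_def split: prod.splits)
    have "emeasure \<Omega> {\<omega>. \<forall>k<n. \<omega> (k, x k) = x (Suc k)} =
       (\<Prod>kj\<in>I. emeasure (case kj of (k, j) \<Rightarrow> measure_pmf (p j)) {x (Suc (fst kj))})"
      unfolding cyl \<Omega>_def
      by (rule \<Omega>.emeasure_PiM_emb) (auto simp: I_def)
    also have "\<dots> = (\<Prod>k<n. ennreal (P (x k) (x (Suc k))))"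
      unfolding I_def
      by (subst prod.reindex) (auto simp: inj_on_def emeasure_pmf_single pmf_p)
    also have "\<dots> = ennreal (\<Prod>k<n. P (x k) (x (Suc k)))"
      using P by (intro prod_ennreal) (auto simp: stochastic_def)
    finally have "measure \<Omega> {\<omega>. \<forall>k<n. \<omega> (k, x k) = x (Suc k)} = (\<Prod>k<n. P (x k) (x (Suc k)))"
      using P by (simp add: measure_def stochastic_def prod_nonneg)
    then show "measure (distr \<Omega> path_space X)
        {\<omega> \<in> space (distr \<Omega> path_space X). \<forall>k\<le>n. \<omega> k = x k} =
        (if x 0 = i then \<Prod>k<n. P (x k) (x (Suc k)) else 0)"
      by (simp add: space_path_space measure_distr[OF XM c] eq sp)
  qed simp
  then show ?thesis ..
qed

lemma ex1_chain_law: "stochastic P \<Longrightarrow> \<exists>!L. is_chain_law P i L"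
  using chain_law_exists chain_law_unique by blast

lemma is_chain_law_chain_law: "stochastic P \<Longrightarrow> is_chain_law P i (chain_law P i)"
  unfolding chain_law_def by (rule theI'[OF ex1_chain_law])


section \<open>Multiple orthogonality\<close>

text \<open>A measure of constant sign on \<open>\<Delta>\<close> is given by a sign \<open>s\<close> (\<open>1\<close> or \<open>- 1\<close>) and a positive
  measure \<open>M\<close> with space \<open>\<Delta>\<close>.\<close>

definition mu_integral :: "real \<Rightarrow> real measure \<Rightarrow> (real \<Rightarrow> real) \<Rightarrow> real" where
  "mu_integral s M f = s * (\<integral>x. f x \<partial>M)"

definition measure_support :: "real measure \<Rightarrow> real set" where
  "measure_support M = {x \<in> space M. \<forall>e>0. 0 < emeasure M (ball x e \<inter> space M)}"

definition multi_size :: "nat \<Rightarrow> (nat \<Rightarrow> nat) \<Rightarrow> nat" where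
  "multi_size p nu = (\<Sum>a=1..p. nu a)"

text \<open>The data of the decomposition
  \<open>i = q |n| + n\<^sub>1 + \<dots> + n\<^bsub>a-1\<^esub> + r\<close> with \<open>1 \<le> a \<le> p\<close> and \<open>r < n\<^sub>a\<close>.\<close>

definition q_idx :: "nat \<Rightarrow> (nat \<Rightarrow> nat) \<Rightarrow> nat \<Rightarrow> nat" where
  "q_idx p ns i = i div multi_size p ns"

definition a_idx :: "nat \<Rightarrow> (nat \<Rightarrow> nat) \<Rightarrow> nat \<Rightarrow> nat" where
  "a_idx p ns i = (LEAST a. i mod multi_size p ns < (\<Sum>b=1..a. ns b))"

definition r_idx :: "nat \<Rightarrow> (nat \<Rightarrow> nat) \<Rightarrow> nat \<Rightarrow> nat" where
  "r_idx p ns i = i mod multi_size p ns - (\<Sum>b=1..<a_idx p ns i. ns b)"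

definition k_idx :: "nat \<Rightarrow> (nat \<Rightarrow> nat) \<Rightarrow> nat \<Rightarrow> nat" where
  "k_idx p ns i = q_idx p ns i * ns (a_idx p ns i) + r_idx p ns i"

lemma idx_decomposition:
  assumes ns: "\<And>a. a \<in> {1..p} \<Longrightarrow> 0 < ns a" and p: "1 \<le> p"
  shows "i = q * multi_size p ns + (\<Sum>b=1..<a. ns b) + r \<and> a \<in> {1..p} \<and> r < ns a \<longleftrightarrow>
    q = q_idx p ns i \<and> a = a_idx p ns i \<and> r = r_idx p ns i"
    (is "?D q a r \<longleftrightarrow> _")
proof -
  let ?n = "multi_size p ns" and ?S = "\<lambda>a. \<Sum>b=1..a. ns b"
  have S: "?S a = (\<Sum>b=1..<a. ns b) + ns a" if "1 \<le> a" for a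
    using sum.last_plus[OF that, of ns] by (simp add: add.commute)
  have mono: "a \<le> b \<Longrightarrow> ?S a \<le> ?S b" for a b
    by (intro sum_mono2) auto
  have pos: "0 < ?n"
    using ns[of 1] p mono[of 1 p] by (simp add: multi_size_def)
  have ex: "i mod ?n < ?S p"
    using pos by (simp add: multi_size_def)
  have 1: "?D (q_idx p ns i) (a_idx p ns i) (r_idx p ns i)"
  proof -
    let ?a = "a_idx p ns i"
    have lt: "i mod ?n < ?S ?a"
      unfolding a_idx_def by (rule LeastI[of _ p]) (rule ex)
    have le: "?a \<le> p" unfolding a_idx_def by (rule Least_le) (rule ex)
    have ge: "1 \<le> ?a" using lt by (cases ?a) auto
    have "\<not> i mod ?n < ?S (?a - 1)"
      unfolding a_idx_def by (rule not_less_Least) (use ge in \<open>simp add: a_idx_def\<close>)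
    moreover have "{1..?a - 1} = {1..<?a}" using ge by auto
    ultimately have "(\<Sum>b=1..<?a. ns b) \<le> i mod ?n" by simp
    then have m: "(\<Sum>b=1..<?a. ns b) + r_idx p ns i = i mod ?n" by (simp add: r_idx_def)
    have "q_idx p ns i * ?n + (\<Sum>b=1..<?a. ns b) + r_idx p ns i = i"
      unfolding add.assoc m q_idx_def by (rule div_mult_mod_eq)
    moreover have "r_idx p ns i < ns ?a" using m lt S[OF ge] by linarith
    ultimately show ?thesis using le ge by simp
  qed
  have 2: "q = q_idx p ns i \<and> a = a_idx p ns i \<and> r = r_idx p ns i" if D: "?D q a r"
  proof -
    have a: "1 \<le> a" "a \<le> p" and r: "r < ns a" using D by auto
    have l: "(\<Sum>b=1..<a. ns b) + r < ?S a" using r S[OF a(1)] by simp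
    also have "\<dots> \<le> ?n" using mono[OF a(2)] by (simp add: multi_size_def)
    finally have lt: "(\<Sum>b=1..<a. ns b) + r < ?n" .
    have i: "i = ((\<Sum>b=1..<a. ns b) + r) + q * ?n" using D by simp
    have m: "i mod ?n = (\<Sum>b=1..<a. ns b) + r" using lt by (simp add: i)
    have d: "i div ?n = q" using lt pos by (simp add: i)
    have "a_idx p ns i = a"
      unfolding a_idx_def m
    proof (rule Least_equality)
      fix b assume b: "(\<Sum>b=1..<a. ns b) + r < ?S b"
      show "a \<le> b"
      proof (rule ccontr)
        assume "\<not> a \<le> b"
        then have "?S b \<le> (\<Sum>b=1..<a. ns b)" by (intro sum_mono2) auto
        then show False using b by simp
      qed
    qed (rule l)
    then show ?thesis using m d by (simp add: q_idx_def r_idx_def)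
  qed
  show ?thesis using 1 2 by blast
qed

definition xi :: "nat \<Rightarrow> (nat \<Rightarrow> nat) \<Rightarrow> (nat \<Rightarrow> real \<Rightarrow> real) \<Rightarrow> nat \<Rightarrow> real \<Rightarrow> real" where
  "xi p ns w i x = x ^ k_idx p ns i * w (a_idx p ns i) x"

text \<open>A multi-index is normal if there is exactly one monic polynomial of degree \<open>|\<nu>|\<close> with the
  type II orthogonality relations; the pair is perfect if all multi-indices are normal.\<close>

definition normal_index ::
  "nat \<Rightarrow> (nat \<Rightarrow> real \<Rightarrow> real) \<Rightarrow> real \<Rightarrow> real measure \<Rightarrow> (nat \<Rightarrow> nat) \<Rightarrow> bool" where
  "normal_index p w s M nu \<longleftrightarrow>
     (\<exists>!B :: real poly. degree B = multi_size p nu \<and> lead_coeff B = 1 \<and>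
        (\<forall>a\<in>{1..p}. \<forall>k<nu a. mu_integral s M (\<lambda>x. x ^ k * poly B x * w a x) = 0))"

definition perfect :: "nat \<Rightarrow> (nat \<Rightarrow> real \<Rightarrow> real) \<Rightarrow> real \<Rightarrow> real measure \<Rightarrow> bool" where
  "perfect p w s M \<longleftrightarrow> (\<forall>nu. normal_index p w s M nu)"

definition typeII_poly ::
  "nat \<Rightarrow> (nat \<Rightarrow> nat) \<Rightarrow> (nat \<Rightarrow> real \<Rightarrow> real) \<Rightarrow> real \<Rightarrow> real measure \<Rightarrow> nat \<Rightarrow> real poly" where
  "typeII_poly p ns w s M l =
     (THE B. degree B = l \<and> lead_coeff B = 1 \<and>
        (\<forall>j<l. mu_integral s M (\<lambda>x. poly B x * xi p ns w j x) = 0))"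

definition typeI_form ::
  "nat \<Rightarrow> (nat \<Rightarrow> nat) \<Rightarrow> (nat \<Rightarrow> real \<Rightarrow> real) \<Rightarrow> real \<Rightarrow> real measure \<Rightarrow> nat \<Rightarrow> real \<Rightarrow> real" where
  "typeI_form p ns w s M l =
     (THE Q. (\<exists>c :: nat \<Rightarrow> real. Q = (\<lambda>x. \<Sum>j\<le>l. c j * xi p ns w j x)) \<and>
        (\<forall>i\<le>l. mu_integral s M (\<lambda>x. x ^ i * Q x) = (if i = l then 1 else 0)))"

definition jacobi_matrix ::
  "nat \<Rightarrow> (nat \<Rightarrow> nat) \<Rightarrow> (nat \<Rightarrow> real \<Rightarrow> real) \<Rightarrow> real \<Rightarrow> real measure \<Rightarrow> nat \<Rightarrow> nat \<Rightarrow> real" where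
  "jacobi_matrix p ns w s M n =
     (THE c. finite {m. c m \<noteq> 0} \<and>
        [:0, 1:] * typeII_poly p ns w s M n =
          (\<Sum>m | c m \<noteq> 0. smult (c m) (typeII_poly p ns w s M m)))"

definition zeros_B ::
  "nat \<Rightarrow> (nat \<Rightarrow> nat) \<Rightarrow> (nat \<Rightarrow> real \<Rightarrow> real) \<Rightarrow> real \<Rightarrow> real measure \<Rightarrow> complex set" where
  "zeros_B p ns w s M = {z. \<exists>n. poly (map_poly of_real (typeII_poly p ns w s M n)) z = 0}"

definition zeros_Q ::
  "real set \<Rightarrow> nat \<Rightarrow> (nat \<Rightarrow> nat) \<Rightarrow> (nat \<Rightarrow> real \<Rightarrow> real) \<Rightarrow> real \<Rightarrow> real measure \<Rightarrow> real set" where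
  "zeros_Q I p ns w s M = {x \<in> I. \<exists>n. typeI_form p ns w s M n x = 0}"

definition abs_bound :: "'a::real_normed_vector set \<Rightarrow> ereal" where
  "abs_bound Z = (SUP z\<in>Z. ereal (norm z))"

text \<open>The matrix \<open>(1 / \<lambda>) \<sigma> A \<sigma>\<^sup>-\<^sup>1\<close> for the diagonal matrix \<open>\<sigma>\<close> with diagonal \<open>d\<close>.\<close>

definition scaled_conjugate ::
  "real \<Rightarrow> (nat \<Rightarrow> real) \<Rightarrow> (nat \<Rightarrow> nat \<Rightarrow> real) \<Rightarrow> nat \<Rightarrow> nat \<Rightarrow> real" where
  "scaled_conjugate lam d A i j = 1 / lam * (d i * A i j * inverse (d j))"

definition P_II ::
  "real \<Rightarrow> nat \<Rightarrow> (nat \<Rightarrow> nat) \<Rightarrow> (nat \<Rightarrow> real \<Rightarrow> real) \<Rightarrow> real \<Rightarrow> real measure \<Rightarrow> nat \<Rightarrow> nat \<Rightarrow> real" where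
  "P_II lam p ns w s M =
     scaled_conjugate lam (\<lambda>n. 1 / poly (typeII_poly p ns w s M n) lam) (jacobi_matrix p ns w s M)"

definition P_I ::
  "real \<Rightarrow> nat \<Rightarrow> (nat \<Rightarrow> nat) \<Rightarrow> (nat \<Rightarrow> real \<Rightarrow> real) \<Rightarrow> real \<Rightarrow> real measure \<Rightarrow> nat \<Rightarrow> nat \<Rightarrow> real" where
  "P_I lam p ns w s M =
     scaled_conjugate lam (\<lambda>n. 1 / typeI_form p ns w s M n lam) (\<lambda>i j. jacobi_matrix p ns w s M j i)"

text \<open>Convergence of \<open>\<integral> w\<^sub>1 / (1 - x / \<lambda>) d\<mu>\<close>. As \<open>1 / 0 = 0\<close>, an atom of
  \<open>w\<^sub>1 d\<mu>\<close> at \<open>\<lambda>\<close> has to be excluded separately; the sign of \<open>\<mu>\<close> is irrelevant here.\<close>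

definition markov_integral_converges :: "(real \<Rightarrow> real) \<Rightarrow> real measure \<Rightarrow> real \<Rightarrow> bool" where
  "markov_integral_converges w1 M lam \<longleftrightarrow>
     integrable M (\<lambda>x. w1 x / (1 - x / lam)) \<and> \<not> (0 < emeasure M {lam} \<and> w1 lam \<noteq> 0)"

locale perfect_pair =
  fixes \<Delta> I :: "real set" and p :: nat and ns :: "nat \<Rightarrow> nat"
    and w :: "nat \<Rightarrow> real \<Rightarrow> real" and s :: real and M :: "real measure"
  assumes interval_Delta: "is_interval \<Delta>"
    and sign: "s = 1 \<or> s = - 1"
    and finite_M: "finite_measure M"
    and sets_M: "sets M = sets (restrict_space borel \<Delta>)"
    and infinite_support: "infinite (measure_support M)"
    and p_ge_1: "1 \<le> p"
    and ns_pos: "\<And>a. a \<in> {1..p} \<Longrightarrow> 0 < ns a"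
    and weight_sign: "\<And>a. a \<in> {1..p} \<Longrightarrow> (\<forall>x\<in>\<Delta>. 0 \<le> w a x) \<or> (\<forall>x\<in>\<Delta>. w a x \<le> 0)"
    and moments: "\<And>a k. a \<in> {1..p} \<Longrightarrow> integrable M (\<lambda>x. x ^ k * w a x)"
    and perfect: "perfect p w s M"
    and interval_I: "is_interval I"
    and I_unbounded: "\<not> bdd_above I"
    and interior_subset: "interior \<Delta> \<subseteq> I"
    and weight_continuous: "\<And>a. a \<in> {1..p} \<Longrightarrow> continuous_on I (w a)"

end

theory Submission
  imports Defs
begin

text \<open>The two matrices are transposes of each other up to diagonal scaling. By biorthogonality of
  the \<open>B\<^sub>i\<close> and \<open>Q\<^sub>j\<close> the powers of \<open>J\<close> have the entries \<open>(J\<^sup>n)\<^sub>i\<^sub>j = \<integral> x\<^sup>n B\<^sub>i Q\<^sub>j d\<mu>\<close>. Hence both chains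
  return to \<open>0\<close> after \<open>n\<close> steps with the same probability \<open>\<integral> (x / \<lambda>)\<^sup>n d\<nu>\<close>, where \<open>\<nu>\<close> is the probability
  measure \<open>w\<^sub>1 d\<mu> / \<integral> w\<^sub>1 d\<mu>\<close>. By the renewal equation and irreducibility, recurrence means that
  these probabilities have infinite sum. They are bounded by \<open>1\<close>, so \<open>\<bar>x\<bar> \<le> \<lambda>\<close> for \<open>\<nu>\<close>-almost all \<open>x\<close>, and
  summing the geometric series under the integral turns their sum into \<open>\<integral> 1 / (1 - x / \<lambda>) d\<nu>\<close>.\<close>

section \<open>Recurrence and return probabilities\<close>

lemma measurable_case_nat_path [measurable]: "case_nat i \<in> measurable path_space path_space"
proof (rule measurable_PiM_single')
  fix k show "(\<lambda>\<omega>. case_nat i \<omega> k) \<in> measurable path_space (count_space UNIV)"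
    by (cases k) auto
qed (auto simp: space_PiM)

lemma all_le_Suc_iff: "(\<forall>l\<le>Suc m. A l) \<longleftrightarrow> A 0 \<and> (\<forall>l\<le>m. A (Suc l))"
  by (metis Suc_le_mono bot_nat_0.extremum not0_implies_Suc)

lemma all_less_Suc_iff: "(\<forall>l<Suc m. A l) \<longleftrightarrow> A 0 \<and> (\<forall>l<m. A (Suc l))"
  by (metis Suc_less_eq not0_implies_Suc zero_less_Suc)

locale stochastic_matrix =
  fixes P :: "nat \<Rightarrow> nat \<Rightarrow> real"
  assumes stochastic_P: "stochastic P"
begin

lemma P_nonneg: "0 \<le> P i j" and P_sums: "P i sums 1"
  using stochastic_P by (auto simp: stochastic_def)

lemma prob_space_chain_law: "prob_space (chain_law P i)"
  and sets_chain_law [measurable_cong]: "sets (chain_law P i) = sets path_space"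
  and chain_law_cylinder: "measure (chain_law P i) {\<omega> \<in> space (chain_law P i). \<forall>k\<le>n. \<omega> k = x k} =
        (if x 0 = i then \<Prod>k<n. P (x k) (x (Suc k)) else 0)"
  using is_chain_law_chain_law[OF stochastic_P, of i] by (auto simp: is_chain_law_def)

lemma space_chain_law: "space (chain_law P i) = UNIV"
  using sets_eq_imp_space_eq[OF sets_chain_law] by (simp add: space_path_space)

text \<open>Row \<open>i\<close> as a probability mass function, so that a mixture of laws over the
  first step can be formed with \<open>bind\<close>.\<close>

definition trans_pmf :: "nat \<Rightarrow> nat pmf" where
  "trans_pmf i = embed_pmf (P i)"

lemma pmf_trans_pmf: "pmf (trans_pmf i) j = P i j"
  unfolding trans_pmf_def
proof (rule pmf_embed_pmf)
  show "(\<integral>\<^sup>+ x. ennreal (P i x) \<partial>count_space UNIV) = 1"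
    unfolding nn_integral_count_space_nat suminf_ennreal_eq[OF P_nonneg P_sums] by simp
qed (rule P_nonneg)

lemma expectation_trans_pmf:
  assumes "\<And>k. 0 \<le> f k" "\<And>k. f k \<le> 1"
  shows "(\<lambda>k. P i k * f k) sums measure_pmf.expectation (trans_pmf i) f"
proof -
  have int: "integrable (trans_pmf i) f"
    by (rule measure_pmf.integrable_const_bound[where B=1]) (use assms in auto)
  have "(\<Sum>k. ennreal (P i k * f k)) = (\<integral>\<^sup>+k. f k \<partial>trans_pmf i)"
    by (simp add: nn_integral_measure_pmf nn_integral_count_space_nat pmf_trans_pmf ennreal_mult' P_nonneg)
  also have "\<dots> = ennreal (measure_pmf.expectation (trans_pmf i) f)"
    by (rule nn_integral_eq_integral[OF int]) (use assms in auto)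
  finally have "(\<lambda>k. ennreal (P i k * f k)) sums ennreal (measure_pmf.expectation (trans_pmf i) f)"
    by (metis summableI summable_sums)
  then show ?thesis
    by (subst (asm) sums_ennreal) (use assms P_nonneg in \<open>auto intro!: Bochner_Integration.integral_nonneg\<close>)
qed

text \<open>Mix the laws started in \<open>k\<close> with weights \<open>P i k\<close>, each shifted
  by prepending \<open>i\<close>. The mixture has the cylinder probabilities of the chain started in
  \<open>i\<close>, so uniqueness of the chain law identifies the two.\<close>

lemma first_step:
  assumes A: "A \<in> sets path_space"
  shows "(\<lambda>k. P i k * measure (chain_law P k) {\<omega>. case_nat i \<omega> \<in> A}) sums measure (chain_law P i) A"
proof -
  define K where "K k = distr (chain_law P k) path_space (case_nat i)" for k
  have m: "case_nat i \<in> measurable (chain_law P k) path_space" for k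
    by (simp add: measurable_cong_sets[OF sets_chain_law refl] measurable_case_nat_path)
  have K: "prob_space (K k)" for k
    unfolding K_def by (rule prob_space.prob_space_distr[OF prob_space_chain_law m])
  have KA: "measure (K k) A = measure (chain_law P k) {\<omega>. case_nat i \<omega> \<in> A}" if "A \<in> sets path_space" for k A
    unfolding K_def by (subst measure_distr[OF m that]) (simp add: space_chain_law vimage_def)
  have meas: "K \<in> measurable (trans_pmf i) (subprob_algebra path_space)"
    using K by (auto simp: space_subprob_algebra K_def prob_space_imp_subprob_space)
  define L where "L = measure_pmf (trans_pmf i) \<bind> K"
  have LA: "measure L A = measure_pmf.expectation (trans_pmf i) (\<lambda>k. measure (K k) A)"
    if "A \<in> sets path_space" for A
    unfolding L_def by (rule measure_pmf.measure_bind[OF meas that])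
  have Lsum: "(\<lambda>k. P i k * measure (chain_law P k) {\<omega>. case_nat i \<omega> \<in> A}) sums measure L A"
    if "A \<in> sets path_space" for A
    unfolding LA[OF that] KA[OF that, symmetric]
    by (rule expectation_trans_pmf) (use K in \<open>auto simp: prob_space.prob_le_1\<close>)
  have sL: "sets L = sets path_space"
    unfolding L_def by (rule sets_bind) (auto simp: K_def)
  have spL: "space L = UNIV"
    using sets_eq_imp_space_eq[OF sL] by (simp add: space_path_space)
  have pL: "prob_space L"
    unfolding L_def
    by (rule measure_pmf.prob_space_bind[OF _ meas]) (use K in auto)
  have "is_chain_law P i L"
    unfolding is_chain_law_def
  proof (intro conjI allI pL sL)
    fix n and x :: "nat \<Rightarrow> nat"
    have "{\<omega> \<in> space path_space. \<forall>k\<le>n. \<omega> k = x k} \<in> sets path_space"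
      by measurable
    then have c: "{\<omega>. \<forall>k\<le>n. \<omega> k = x k} \<in> sets path_space"
      by (simp add: space_path_space)
    have s: "(\<lambda>k. P i k * measure (chain_law P k) {\<omega>. \<forall>l\<le>n. case_nat i \<omega> l = x l}) sums measure L {\<omega>. \<forall>k\<le>n. \<omega> k = x k}"
      using Lsum[OF c] by simp
    show "measure L {\<omega> \<in> space L. \<forall>k\<le>n. \<omega> k = x k} = (if x 0 = i then \<Prod>k<n. P (x k) (x (Suc k)) else 0)"
    proof (cases n)
      case 0
      have "(\<lambda>k. P i k * (if x 0 = i then 1 else 0)) sums measure L {\<omega>. \<forall>k\<le>n. \<omega> k = x k}"
        using s by (auto simp: 0 prob_space.prob_space[OF prob_space_chain_law, unfolded space_chain_law])
      moreover have "(\<lambda>k. P i k * (if x 0 = i then 1 else 0)) sums (1 * (if x 0 = i then 1 else 0))"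
        by (intro sums_mult2 P_sums)
      ultimately have "measure L {\<omega>. \<forall>k\<le>n. \<omega> k = x k} = (if x 0 = i then 1 else 0)"
        using sums_unique2 by fastforce
      then show ?thesis by (simp add: 0 spL)
    next
      case (Suc m)
      have e: "{\<omega>. \<forall>l\<le>n. case_nat i \<omega> l = x l} = (if x 0 = i then {\<omega>. \<forall>l\<le>m. \<omega> l = x (Suc l)} else {})"
      proof -
        have "(\<forall>l\<le>n. case_nat i \<omega> l = x l) \<longleftrightarrow> x 0 = i \<and> (\<forall>l\<le>m. \<omega> l = x (Suc l))" for \<omega>
          unfolding Suc all_le_Suc_iff by auto
        then show ?thesis by auto
      qed
      \<comment> \<open>The remaining cylinder prescribes the starting state \<open>x 1\<close>, so
        only the term \<open>k = x 1\<close> of the series survives.\<close>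
      have mm: "measure (chain_law P k) {\<omega>. \<forall>l\<le>n. case_nat i \<omega> l = x l} =
          (if k = x 1 then (if x 0 = i then \<Prod>l<m. P (x (Suc l)) (x (Suc (Suc l))) else 0) else 0)" for k
        using chain_law_cylinder[of k m "\<lambda>l. x (Suc l)"] by (auto simp: e space_chain_law)
      have "(\<lambda>k. if k = x 1 then P i k * (if x 0 = i then \<Prod>l<m. P (x (Suc l)) (x (Suc (Suc l))) else 0) else 0)
         sums measure L {\<omega>. \<forall>k\<le>n. \<omega> k = x k}"
        using s unfolding mm by (cases "x 0 = i") (simp_all add: if_distrib[of "\<lambda>y. _ * y"] cong: if_cong)
      moreover have "(\<lambda>k. if k = x 1 then P i k * (if x 0 = i then \<Prod>l<m. P (x (Suc l)) (x (Suc (Suc l))) else 0) else 0)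
         sums (P i (x 1) * (if x 0 = i then \<Prod>l<m. P (x (Suc l)) (x (Suc (Suc l))) else 0))"
        by (rule sums_single)
      ultimately have "measure L {\<omega>. \<forall>k\<le>n. \<omega> k = x k} =
          P i (x 1) * (if x 0 = i then \<Prod>l<m. P (x (Suc l)) (x (Suc (Suc l))) else 0)"
        by (rule sums_unique2)
      then show ?thesis by (auto simp: Suc spL prod.lessThan_Suc_shift simp del: prod.lessThan_Suc)
    qed
  qed
  then have "L = chain_law P i"
    using chain_law_unique is_chain_law_chain_law[OF stochastic_P] by blast
  then show ?thesis using Lsum[OF A] by simp
qed

lemma first_step_Collect:
  assumes "Measurable.pred path_space A"
  shows "(\<lambda>k. P i k * measure (chain_law P k) {\<omega>. A (case_nat i \<omega>)}) sums measure (chain_law P i) {\<omega>. A \<omega>}"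
proof -
  have "{\<omega>. A \<omega>} \<in> sets path_space"
    using predE[OF assms] by (simp add: space_path_space)
  from first_step[OF this] show ?thesis by simp
qed

section \<open>Step probabilities and first-passage probabilities\<close>

definition step_prob :: "nat \<Rightarrow> nat \<Rightarrow> nat \<Rightarrow> real" where
  "step_prob n i j = measure (chain_law P i) {\<omega>. \<omega> n = j}"

text \<open>The index is shifted: the first visit to \<open>j\<close> at a positive time happens at
  time \<open>Suc n\<close>. Time 0 is ignored, so \<open>i = j\<close> gives the first
  return.\<close>

definition passage_prob :: "nat \<Rightarrow> nat \<Rightarrow> nat \<Rightarrow> real" where
  "passage_prob n i j = measure (chain_law P i) {\<omega>. \<omega> (Suc n) = j \<and> (\<forall>k<n. \<omega> (Suc k) \<noteq> j)}"

lemma step_prob_bounds: "0 \<le> step_prob n i j" "step_prob n i j \<le> 1"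
  by (simp_all add: step_prob_def prob_space.prob_le_1[OF prob_space_chain_law])

lemma passage_prob_nonneg: "0 \<le> passage_prob n i j"
  by (simp add: passage_prob_def)

lemma chain_law_start: "measure (chain_law P i) {\<omega>. \<omega> 0 = j \<and> A} = (if i = j \<and> A then 1 else 0)"
  using chain_law_cylinder[of i 0 "\<lambda>_. j"] by (cases A) (auto simp: space_chain_law)

lemma step_prob_0: "step_prob 0 i j = (if i = j then 1 else 0)"
  using chain_law_start[of i j True] by (simp add: step_prob_def)

lemma step_prob_Suc: "(\<lambda>k. P i k * step_prob n k j) sums step_prob (Suc n) i j"
  using first_step_Collect[of "\<lambda>\<omega>. \<omega> (Suc n) = j" i] by (simp add: step_prob_def)

lemma passage_prob_0: "passage_prob 0 i j = P i j"
proof -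
  have "(\<lambda>k. P i k * step_prob 0 k j) sums passage_prob 0 i j"
    using step_prob_Suc[of i 0 j] by (simp add: step_prob_def passage_prob_def)
  moreover have "(\<lambda>k. P i k * step_prob 0 k j) = (\<lambda>k. if k = j then P i k else 0)"
    by (auto simp: step_prob_0)
  moreover have "(\<lambda>k. if k = j then P i k else 0) sums P i j"
    by (rule sums_single)
  ultimately show ?thesis
    by (metis sums_unique2)
qed

text \<open>A first step into \<open>j\<close> would already be the passage, so for passage at a
  later time the term \<open>k = j\<close> drops out.\<close>

lemma passage_prob_Suc:
  "(\<lambda>k. if k = j then 0 else P i k * passage_prob n k j) sums passage_prob (Suc n) i j"
proof -
  let ?A = "\<lambda>\<omega>. \<omega> (Suc (Suc n)) = j \<and> (\<forall>k<Suc n. \<omega> (Suc k) \<noteq> j)"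
  have 1: "(\<lambda>k. P i k * measure (chain_law P k) {\<omega>. ?A (case_nat i \<omega>)}) sums passage_prob (Suc n) i j"
    using first_step_Collect[of ?A i] by (simp add: passage_prob_def)
  \<comment> \<open>After prepending \<open>i\<close>, avoiding \<open>j\<close> at time 1 is a
    condition on the starting state of the remaining path, which is almost surely
    \<open>k\<close>.\<close>
  have e: "{\<omega>. ?A (case_nat i \<omega>)} = {\<omega>. \<omega> (Suc n) = j \<and> (\<forall>k<n. \<omega> (Suc k) \<noteq> j)} - {\<omega>. \<omega> 0 = j}"
    unfolding all_less_Suc_iff by auto
  have 2: "measure (chain_law P k) {\<omega>. ?A (case_nat i \<omega>)} = (if k = j then 0 else passage_prob n k j)" for k
  proof -
    interpret L: prob_space "chain_law P k" by (rule prob_space_chain_law)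
    have m0: "{\<omega> \<in> space path_space. \<omega> 0 = j} \<in> sets path_space" by measurable
    have m1: "{\<omega> \<in> space path_space. \<omega> (Suc n) = j \<and> (\<forall>k<n. \<omega> (Suc k) \<noteq> j)} \<in> sets path_space" by measurable
    have m: "{\<omega>. \<omega> 0 = j} \<in> sets (chain_law P k)"
      "{\<omega>. \<omega> (Suc n) = j \<and> (\<forall>k<n. \<omega> (Suc k) \<noteq> j)} \<in> sets (chain_law P k)"
      using m0 m1 by (simp_all add: sets_chain_law space_path_space)
    show ?thesis
    proof (cases "k = j")
      case True
      have "L.prob {\<omega>. \<omega> 0 = j} = 1" using chain_law_start[of k j True] True by simp
      then have "L.prob (space (chain_law P k) - {\<omega>. \<omega> 0 = j}) = 0"
        using L.prob_compl[OF m(1)] by simp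
      moreover have "L.prob {\<omega>. ?A (case_nat i \<omega>)} \<le> L.prob (space (chain_law P k) - {\<omega>. \<omega> 0 = j})"
        unfolding e by (rule L.finite_measure_mono) (use sets.compl_sets[OF m(1)] in \<open>auto simp: space_chain_law\<close>)
      ultimately show ?thesis using True by (simp add: measure_le_0_iff)
    next
      case False
      have "L.prob {\<omega>. \<omega> 0 = j} = 0" using chain_law_start[of k j True] False by simp
      then have "{\<omega>. \<omega> 0 = j} \<in> null_sets (chain_law P k)"
        using m(1) by (auto intro!: null_setsI simp: L.emeasure_eq_measure)
      then show ?thesis unfolding e
        using False m(2) by (simp add: measure_Diff_null_set passage_prob_def)
    qed
  qed
  have "(\<lambda>k. P i k * (if k = j then 0 else passage_prob n k j)) =
      (\<lambda>k. if k = j then 0 else P i k * passage_prob n k j)"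
    by auto
  then show ?thesis using 1 unfolding 2 by simp
qed

section \<open>Renewal equation and the criterion for recurrence\<close>

text \<open>Decomposition by the first visit to \<open>j\<close>, obtained by first-step analysis in
  place of a strong Markov property: a first step into \<open>j\<close> gives the summand
  \<open>k = 0\<close>, any other first step is covered by the induction hypothesis.\<close>

lemma renewal: "step_prob (Suc n) i j = (\<Sum>k\<le>n. passage_prob k i j * step_prob (n - k) j j)"
proof (induction n arbitrary: i)
  case 0
  have "step_prob (Suc 0) i j = passage_prob 0 i j"
    by (simp add: step_prob_def passage_prob_def)
  then show ?case by (simp add: step_prob_0)
next
  case (Suc n)
  have s: "(\<lambda>k. (if k = j then 0 else P i k * passage_prob m k j) * step_prob (n - m) j j)
      sums (passage_prob (Suc m) i j * step_prob (n - m) j j)" for m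
    by (rule sums_mult2[OF passage_prob_Suc])
  have A: "(\<lambda>k. (if k = j then P i k * step_prob (Suc n) k j else 0) +
        (\<Sum>m\<le>n. (if k = j then 0 else P i k * passage_prob m k j) * step_prob (n - m) j j))
      sums (P i j * step_prob (Suc n) j j + (\<Sum>m\<le>n. passage_prob (Suc m) i j * step_prob (n - m) j j))"
    by (rule sums_add, rule sums_single, rule sums_sum, rule s)
  have E: "(\<lambda>k. (if k = j then P i k * step_prob (Suc n) k j else 0) +
        (\<Sum>m\<le>n. (if k = j then 0 else P i k * passage_prob m k j) * step_prob (n - m) j j))
      = (\<lambda>k. P i k * step_prob (Suc n) k j)"
  proof
    fix k
    have "(\<Sum>m\<le>n. (if k = j then 0 else P i k * passage_prob m k j) * step_prob (n - m) j j)
      = (if k = j then 0 else P i k * step_prob (Suc n) k j)"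
      unfolding Suc[of k] by (simp add: sum_distrib_left mult.assoc)
    then show "(if k = j then P i k * step_prob (Suc n) k j else 0) +
        (\<Sum>m\<le>n. (if k = j then 0 else P i k * passage_prob m k j) * step_prob (n - m) j j)
        = P i k * step_prob (Suc n) k j"
      by simp
  qed
  have F: "step_prob (Suc (Suc n)) i j =
      P i j * step_prob (Suc n) j j + (\<Sum>m\<le>n. passage_prob (Suc m) i j * step_prob (n - m) j j)"
    by (rule sums_unique2[OF step_prob_Suc A[unfolded E]])
  show ?case
    unfolding sum.atMost_Suc_shift passage_prob_0 F diff_Suc_Suc diff_zero ..
qed

text \<open>The event of returning is the disjoint union, over all times, of the events that the
  first return happens then.\<close>

lemma return_prob_sums:
  "(\<lambda>n. passage_prob n i i) sums measure (chain_law P i) {\<omega>. \<exists>n\<ge>1. \<omega> n = i}"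
proof -
  interpret L: prob_space "chain_law P i" by (rule prob_space_chain_law)
  let ?A = "\<lambda>n. {\<omega> :: nat \<Rightarrow> nat. \<omega> (Suc n) = i \<and> (\<forall>k<n. \<omega> (Suc k) \<noteq> i)}"
  have "{\<omega> \<in> space path_space. \<omega> (Suc n) = i \<and> (\<forall>k<n. \<omega> (Suc k) \<noteq> i)} \<in> sets path_space" for n by measurable
  then have m: "?A n \<in> sets (chain_law P i)" for n
    by (simp add: sets_chain_law space_path_space)
  have d: "disjoint_family ?A"
    unfolding disjoint_family_on_def
  proof (intro ballI impI)
    fix m n :: nat assume "m \<noteq> n"
    then consider "m < n" | "n < m" by linarith
    then show "?A m \<inter> ?A n = {}" by cases auto
  qed
  have "(\<Union>n. ?A n) = {\<omega>. \<exists>n\<ge>1. \<omega> n = i}"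
  proof (intro set_eqI iffI)
    fix \<omega> :: "nat \<Rightarrow> nat" assume "\<omega> \<in> {\<omega>. \<exists>n\<ge>1. \<omega> n = i}"
    then have "\<exists>n. \<omega> (Suc n) = i" using Suc_le_D by fastforce
    then have "\<exists>n. \<omega> (Suc n) = i \<and> (\<forall>k<n. \<omega> (Suc k) \<noteq> i)"
      by (rule exists_least_iff[THEN iffD1])
    then show "\<omega> \<in> (\<Union>n. ?A n)" by blast
  next
    fix \<omega> assume "\<omega> \<in> (\<Union>n. ?A n)"
    then obtain n where "\<omega> (Suc n) = i" by blast
    then show "\<omega> \<in> {\<omega>. \<exists>n\<ge>1. \<omega> n = i}" by (intro CollectI exI[of _ "Suc n"]) simp
  qed
  moreover have "(\<lambda>n. L.prob (?A n)) sums L.prob (\<Union>n. ?A n)"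
    by (rule L.finite_measure_UNION) (use m d in auto)
  ultimately show ?thesis by (simp add: passage_prob_def)
qed

text \<open>Let \<open>R\<close> be the return probability and \<open>u\<close> the step
  probabilities. If \<open>u\<close> has a finite sum \<open>U\<close>, the renewal equation summed
  over all times reads \<open>U - 1 = R * U\<close>, which excludes \<open>R = 1\<close>. If
  \<open>R < 1\<close>, each partial sum \<open>S\<close> satisfies \<open>S \<le> 1 + R * S\<close>
  and is therefore bounded.\<close>

lemma recurrent_state_iff: "recurrent_state P i \<longleftrightarrow> \<not> summable (\<lambda>n. step_prob n i i)"
proof -
  define R where "R = measure (chain_law P i) {\<omega>. \<exists>n\<ge>1. \<omega> n = i}"
  let ?f = "\<lambda>n. passage_prob n i i" and ?u = "\<lambda>n. step_prob n i i"
  have f: "?f sums R" unfolding R_def by (rule return_prob_sums)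
  have R: "R \<le> 1" by (simp add: R_def prob_space.prob_le_1[OF prob_space_chain_law])
  have rec: "recurrent_state P i \<longleftrightarrow> R = 1"
    by (simp add: recurrent_state_def R_def space_chain_law)
  have "R \<noteq> 1" if u: "summable ?u"
  proof -
    have "summable (\<lambda>k. norm (?f k))" "summable (\<lambda>k. norm (?u k))"
      using f u by (simp_all add: passage_prob_nonneg step_prob_bounds sums_iff)
    from Cauchy_product[OF this] have "(\<Sum>n. ?u (Suc n)) = R * suminf ?u"
      using f by (simp only: renewal sums_iff)
    moreover have "(\<Sum>n. ?u (Suc n)) = suminf ?u - 1"
      using suminf_split_head[OF u] by (simp add: step_prob_0)
    ultimately show ?thesis by auto
  qed
  moreover have "summable ?u" if "R \<noteq> 1"
  proof -
    have R1: "R < 1" using R that by simp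
    have "(\<Sum>n<N. ?u n) \<le> 1 / (1 - R)" for N
    proof (cases N)
      case (Suc m)
      have "(\<Sum>n<m. ?u (Suc n)) = (\<Sum>n<m. \<Sum>k\<le>n. ?f k * ?u (n - k))"
        by (simp add: renewal)
      also have "\<dots> = (\<Sum>k<m. \<Sum>l<m-k. ?f k * ?u l)"
      proof -
        have "{(k, l). k + l < m} = Sigma {..<m} (\<lambda>k. {..<m - k})" by auto
        then show ?thesis
          using sum.triangle_reindex[of "\<lambda>k l. ?f k * ?u l" m] by (simp add: sum.Sigma)
      qed
      \<comment> \<open>All terms are nonnegative, so the triangle may be enlarged to a rectangle,
        on which the double sum factors.\<close>
      also have "\<dots> \<le> (\<Sum>k<m. \<Sum>l<N. ?f k * ?u l)"
        by (intro sum_mono sum_mono2) (auto simp: passage_prob_nonneg step_prob_bounds Suc)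
      also have "\<dots> = (\<Sum>k<m. ?f k) * (\<Sum>l<N. ?u l)"
        by (simp add: sum_product)
      also have "\<dots> \<le> R * (\<Sum>l<N. ?u l)"
      proof (rule mult_right_mono)
        show "(\<Sum>k<m. ?f k) \<le> R"
          using sum_le_suminf[of ?f "{..<m}"] f by (simp add: passage_prob_nonneg sums_iff)
      qed (intro sum_nonneg step_prob_bounds)
      finally have "(\<Sum>n<N. ?u n) \<le> 1 + R * (\<Sum>n<N. ?u n)"
        by (simp add: Suc sum.lessThan_Suc_shift step_prob_0 del: sum.lessThan_Suc)
      then show ?thesis using R1 by (simp add: field_simps)
    qed (use R1 in auto)
    then show ?thesis
      by (intro summableI_nonneg_bounded step_prob_bounds)
  qed
  ultimately show ?thesis unfolding rec by blast
qed

section \<open>Recurrence as a class property\<close>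

text \<open>The left side is a single summand of the Chapman-Kolmogorov sum, so termwise comparison
  suffices.\<close>

lemma step_prob_compose_le: "step_prob m i j * step_prob n j k \<le> step_prob (m + n) i k"
proof (induction m arbitrary: i)
  case 0
  then show ?case by (simp add: step_prob_0 step_prob_bounds)
next
  case (Suc m)
  have "(\<lambda>l. P i l * step_prob m l j * step_prob n j k) sums (step_prob (Suc m) i j * step_prob n j k)"
    by (rule sums_mult2[OF step_prob_Suc])
  moreover have "(\<lambda>l. P i l * step_prob (m + n) l k) sums step_prob (Suc m + n) i k"
    using step_prob_Suc[of i "m + n" k] by simp
  ultimately show ?case
  proof (rule sums_le[rotated])
    fix l show "P i l * step_prob m l j * step_prob n j k \<le> P i l * step_prob (m + n) l k"
      using mult_left_mono[OF Suc P_nonneg] by (simp add: mult.assoc)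
  qed
qed

text \<open>Going from \<open>j\<close> to \<open>i\<close> in \<open>a\<close> steps, looping at
  \<open>i\<close> for \<open>n\<close> steps and returning in \<open>b\<close> steps is one way to
  get from \<open>j\<close> to \<open>j\<close>; irreducibility makes the two connecting factors
  positive.\<close>

lemma summable_step_prob_transfer:
  assumes irr: "irreducible_chain P" and "summable (\<lambda>n. step_prob n j j)"
  shows "summable (\<lambda>n. step_prob n i i)"
proof -
  obtain a b where ab: "0 < step_prob a j i" "0 < step_prob b i j"
    using irr unfolding irreducible_chain_def step_prob_def by (simp add: space_chain_law) blast
  let ?c = "step_prob a j i * step_prob b i j"
  have "summable (\<lambda>n. step_prob (n + (a + b)) j j / ?c)"
    by (intro summable_divide summable_ignore_initial_segment assms)
  moreover have "norm (step_prob n i i) \<le> step_prob (n + (a + b)) j j / ?c" for n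
  proof -
    have "?c * step_prob n i i \<le> step_prob (a + n) j i * step_prob b i j"
      using mult_right_mono[OF step_prob_compose_le[of a j i n i] step_prob_bounds(1)[of b i j]]
      by (simp add: mult_ac)
    also have "\<dots> \<le> step_prob (n + (a + b)) j j"
      using step_prob_compose_le[of "a + n" j i b j] by (simp add: add_ac)
    finally show ?thesis using ab by (simp add: field_simps step_prob_bounds)
  qed
  ultimately show ?thesis
    by (rule summable_comparison_test'[where N = 0])
qed

lemma recurrent_chain_iff:
  assumes "irreducible_chain P"
  shows "recurrent_chain P \<longleftrightarrow> \<not> summable (\<lambda>n. step_prob n i i)"
  unfolding recurrent_chain_def recurrent_state_iff
  using summable_step_prob_transfer[OF assms] by blast

lemma transient_chain_iff:
  assumes "irreducible_chain P"
  shows "transient_chain P \<longleftrightarrow> summable (\<lambda>n. step_prob n i i)"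
  unfolding transient_chain_def transient_state_def recurrent_state_iff
  using summable_step_prob_transfer[OF assms] by blast

end

section \<open>Summability of moments\<close>

text \<open>Markov's inequality for even powers: the set where
  \<open>\<bar>g\<bar> \<ge> q > 1\<close> has measure at most \<open>C / q^(2n)\<close> for every
  \<open>n\<close>, hence measure zero.\<close>

lemma AE_abs_le_1_of_bounded_moments:
  fixes g :: "'a \<Rightarrow> real"
  assumes "finite_measure N" and [measurable]: "g \<in> borel_measurable N"
    and int: "\<And>n. integrable N (\<lambda>x. g x ^ n)"
    and le: "\<And>n. (\<integral>x. g x ^ n \<partial>N) \<le> C"
  shows "AE x in N. \<bar>g x\<bar> \<le> 1"
proof -
  interpret finite_measure N by fact
  have null: "AE x in N. \<bar>g x\<bar> < q" if q: "1 < q" for q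
  proof -
    let ?A = "{x \<in> space N. q \<le> \<bar>g x\<bar>}"
    have A: "?A \<in> sets N" by measurable
    have bound: "measure N ?A \<le> C * inverse (q ^ 2) ^ n" for n
    proof -
      have "measure N ?A * (q ^ 2) ^ n = (\<integral>x. indicator ?A x * (q ^ 2) ^ n \<partial>N)"
        using A by simp
      also have "\<dots> \<le> (\<integral>x. g x ^ (2 * n) \<partial>N)"
      proof (rule integral_mono_AE)
        show "AE x in N. indicator ?A x * (q ^ 2) ^ n \<le> g x ^ (2 * n)"
        proof (rule AE_I2)
          fix x
          show "indicator ?A x * (q ^ 2) ^ n \<le> g x ^ (2 * n)"
            using q power_mono[of q "\<bar>g x\<bar>" "2 * n"]
            by (auto simp: indicator_def power_mult[symmetric] power_even_abs)
        qed
        show "integrable N (\<lambda>x. indicator ?A x * (q ^ 2) ^ n)"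
          using A by (intro integrable_mult_left integrable_real_indicator) (auto simp: less_top[symmetric])
      qed (rule int)
      also have "\<dots> \<le> C" by (rule le)
      finally show ?thesis using q by (simp add: field_simps)
    qed
    have "(\<lambda>n. C * inverse (q ^ 2) ^ n) \<longlonglongrightarrow> C * 0"
      using q by (intro tendsto_mult tendsto_const LIMSEQ_power_zero) (simp add: inverse_less_1_iff)
    then have "measure N ?A \<le> C * 0"
      by (rule LIMSEQ_le_const) (use bound in blast)
    then have "emeasure N ?A = 0"
      by (simp add: emeasure_eq_measure measure_le_0_iff)
    then show ?thesis
      by (subst AE_iff_measurable[OF A]) (auto simp: not_less)
  qed
  \<comment> \<open>Countably many thresholds decreasing to 1, so that the null sets can be
    united.\<close>
  have "AE x in N. \<forall>n. \<bar>g x\<bar> < 1 + inverse (real (Suc n))"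
    unfolding AE_all_countable by (intro allI null) simp
  then show ?thesis
  proof eventually_elim
    case (elim x)
    have "(\<lambda>n. 1 + inverse (real (Suc n))) \<longlonglongrightarrow> 1 + 0"
      by (intro tendsto_add tendsto_const LIMSEQ_inverse_real_of_nat)
    then have "\<bar>g x\<bar> \<le> 1 + 0"
      by (rule LIMSEQ_le_const) (use elim in \<open>auto intro: less_imp_le\<close>)
    then show ?case by simp
  qed
qed

section \<open>The geometric series under the integral\<close>

text \<open>Even partial sums agree with those of the pairs, and nonnegativity bounds the odd ones
  by the next even one.\<close>

lemma summable_pairs_iff:
  fixes a :: "nat \<Rightarrow> real"
  assumes a: "\<And>n. 0 \<le> a n"
  shows "summable a \<longleftrightarrow> summable (\<lambda>k. a (2 * k) + a (2 * k + 1))"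
proof
  assume "summable a"
  from sums_group[OF summable_sums[OF this], of 2] show "summable (\<lambda>k. a (2 * k) + a (2 * k + 1))"
    by (simp add: sums_iff numeral_2_eq_2 mult.commute)
next
  assume s: "summable (\<lambda>k. a (2 * k) + a (2 * k + 1))"
  have e: "(\<Sum>n<2 * N. a n) = (\<Sum>k<N. a (2 * k) + a (2 * k + 1))" for N
    by (induction N) auto
  have "(\<Sum>n<N. a n) \<le> (\<Sum>k. a (2 * k) + a (2 * k + 1))" for N
  proof -
    have "(\<Sum>n<N. a n) \<le> (\<Sum>n<2 * N. a n)"
      using a by (intro sum_mono2) auto
    also have "\<dots> \<le> (\<Sum>k. a (2 * k) + a (2 * k + 1))"
      unfolding e using s a by (intro sum_le_suminf) auto
    finally show ?thesis .
  qed
  then show "summable a"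
    using a by (intro summableI_nonneg_bounded)
qed

text \<open>The terms of the geometric series may change sign. Adding them in pairs \<open>g\<^sup>2\<^sup>k(1 + g) \<ge> 0\<close>
  makes monotone convergence applicable.\<close>

lemma suminf_paired_geometric:
  fixes y :: real
  assumes y: "\<bar>y\<bar> \<le> 1"
  shows "(\<Sum>k. ennreal (y ^ (2 * k) + y ^ (2 * k + 1))) =
    (if y = 1 then \<infinity> else if y = - 1 then 0 else ennreal (1 / (1 - y)))"
proof -
  consider "y = 1" | "y = - 1" | "\<bar>y\<bar> < 1" using y by linarith
  then show ?thesis
  proof cases
    case 1
    have "\<not> summable (\<lambda>k::nat. 2 :: real)" by (auto dest!: summable_LIMSEQ_zero simp: LIMSEQ_const_iff)
    then have "(\<Sum>k::nat. ennreal 2) = top"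
      using summable_suminf_not_top[of "\<lambda>_. 2"] by auto
    then show ?thesis using 1 by simp
  next
    case 2
    then show ?thesis by simp
  next
    case 3
    have y2: "norm (y ^ 2) < 1"
      using 3 by (simp add: abs_square_less_1)
    have "(\<lambda>k. (1 + y) * (y ^ 2) ^ k) sums ((1 + y) * (1 / (1 - y ^ 2)))"
      by (rule sums_mult[OF geometric_sums[OF y2]])
    moreover have "(1 + y) * (1 / (1 - y ^ 2)) = 1 / (1 - y)"
    proof -
      have "1 - y ^ 2 = (1 + y) * (1 - y)" by (simp add: algebra_simps power2_eq_square)
      then show ?thesis using 3 by simp
    qed
    moreover have "(\<lambda>k. (1 + y) * (y ^ 2) ^ k) = (\<lambda>k. y ^ (2 * k) + y ^ (2 * k + 1))"
      by (simp add: power_mult[symmetric] algebra_simps)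
    ultimately have s: "(\<lambda>k. y ^ (2 * k) + y ^ (2 * k + 1)) sums (1 / (1 - y))" by metis
    have nn: "0 \<le> y ^ (2 * k) + y ^ (2 * k + 1)" for k
    proof -
      have "y ^ (2 * k) + y ^ (2 * k + 1) = (y ^ 2) ^ k * (1 + y)"
        by (simp add: power_mult[symmetric] algebra_simps)
      then show ?thesis using 3 by simp
    qed
    have "(\<Sum>k. ennreal (y ^ (2 * k) + y ^ (2 * k + 1))) = ennreal (1 / (1 - y))"
      by (rule suminf_ennreal_eq[OF nn s])
    moreover have "y \<noteq> 1" "y \<noteq> - 1" using 3 by auto
    ultimately show ?thesis by simp
  qed
qed

text \<open>Nonnegative moments allow grouping in pairs on the side of the sequence;
  \<open>\<bar>g\<bar> \<le> 1\<close> makes the paired integrands nonnegative, so sum and integral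
  may be exchanged. Since \<open>1 / 0 = 0\<close>, the condition \<open>g x \<noteq> 1\<close> has
  to be stated beside integrability.\<close>

lemma summable_moments_iff:
  fixes g :: "'a \<Rightarrow> real"
  assumes fin: "finite_measure N" and [measurable]: "g \<in> borel_measurable N"
    and int: "\<And>n. integrable N (\<lambda>x. g x ^ n)"
    and nonneg: "\<And>n. 0 \<le> (\<integral>x. g x ^ n \<partial>N)"
    and le: "\<And>n. (\<integral>x. g x ^ n \<partial>N) \<le> C"
  shows "summable (\<lambda>n. \<integral>x. g x ^ n \<partial>N) \<longleftrightarrow>
    integrable N (\<lambda>x. 1 / (1 - g x)) \<and> (AE x in N. g x \<noteq> 1)"
proof -
  interpret finite_measure N by fact
  have AE1: "AE x in N. \<bar>g x\<bar> \<le> 1"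
    by (rule AE_abs_le_1_of_bounded_moments[OF fin _ int le]) measurable
  define h where "h k x = g x ^ (2 * k) + g x ^ (2 * k + 1)" for k x
  define b where "b k = (\<integral>x. g x ^ (2 * k) \<partial>N) + (\<integral>x. g x ^ (2 * k + 1) \<partial>N)" for k
  \<comment> \<open>The pointwise sum of the paired series, with its two exceptional values at the
    endpoints.\<close>
  define \<phi> where "\<phi> y = (if y = 1 then \<infinity> else if y = - 1 then 0 else ennreal (1 / (1 - y)))" for y :: real
  have [measurable]: "h k \<in> borel_measurable N" for k unfolding h_def by measurable
  have inth: "integrable N (h k)" for k
    unfolding h_def by (intro Bochner_Integration.integrable_add int)
  have bh: "b k = (\<integral>x. h k x \<partial>N)" for k
    unfolding b_def h_def by (rule Bochner_Integration.integral_add[symmetric]; rule int)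
  have b0: "0 \<le> b k" for k unfolding b_def by (intro add_nonneg_nonneg nonneg)
  have "AE x in N. 0 \<le> h k x" for k
    using AE1
  proof eventually_elim
    case (elim x)
    have "h k x = (g x ^ 2) ^ k * (1 + g x)"
      by (simp add: h_def power_mult[symmetric] algebra_simps)
    then show ?case using elim by simp
  qed
  then have nnh: "(\<integral>\<^sup>+x. ennreal (h k x) \<partial>N) = ennreal (b k)" for k
    unfolding bh by (rule nn_integral_eq_integral[OF inth])
  have eq: "(\<integral>\<^sup>+x. \<phi> (g x) \<partial>N) = (\<Sum>k. ennreal (b k))"
  proof -
    have "(\<integral>\<^sup>+x. \<phi> (g x) \<partial>N) = (\<integral>\<^sup>+x. (\<Sum>k. ennreal (h k x)) \<partial>N)"
    proof (rule nn_integral_cong_AE)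
      show "AE x in N. \<phi> (g x) = (\<Sum>k. ennreal (h k x))"
        using AE1
      proof eventually_elim
        case (elim x)
        then show ?case
          using suminf_paired_geometric[of "g x"] by (simp only: \<phi>_def h_def)
      qed
    qed
    also have "\<dots> = (\<Sum>k. \<integral>\<^sup>+x. ennreal (h k x) \<partial>N)"
      by (rule nn_integral_suminf) measurable
    finally show ?thesis by (simp only: nnh)
  qed
  have [measurable]: "(\<lambda>x. \<phi> (g x)) \<in> borel_measurable N"
    unfolding \<phi>_def by measurable
  have "summable (\<lambda>n. \<integral>x. g x ^ n \<partial>N) \<longleftrightarrow> summable b"
    unfolding b_def by (rule summable_pairs_iff[OF nonneg])
  also have "\<dots> \<longleftrightarrow> (\<integral>\<^sup>+x. \<phi> (g x) \<partial>N) \<noteq> \<infinity>"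
  proof
    assume "summable b"
    then have "(\<Sum>k. ennreal (b k)) = ennreal (suminf b)"
      by (intro suminf_ennreal2 b0)
    then show "(\<integral>\<^sup>+x. \<phi> (g x) \<partial>N) \<noteq> \<infinity>" by (simp add: eq)
  next
    assume "(\<integral>\<^sup>+x. \<phi> (g x) \<partial>N) \<noteq> \<infinity>"
    then show "summable b"
      unfolding eq by (intro summable_suminf_not_top b0) simp
  qed
  also have "\<dots> \<longleftrightarrow> integrable N (\<lambda>x. 1 / (1 - g x)) \<and> (AE x in N. g x \<noteq> 1)"
  proof
    assume fin: "(\<integral>\<^sup>+x. \<phi> (g x) \<partial>N) \<noteq> \<infinity>"
    have "AE x in N. \<phi> (g x) \<noteq> \<infinity>"
      by (rule nn_integral_PInf_AE) (use fin in \<open>auto simp: less_top\<close>)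
    then have ae: "AE x in N. g x \<noteq> 1"
      by eventually_elim (auto simp: \<phi>_def)
    \<comment> \<open>The summand 1 is for the points with \<open>g x = - 1\<close>, where
      \<open>\<phi>\<close> is 0 but the integrand is 1/2; its integral is finite because
      \<open>N\<close> is.\<close>
    have "(\<integral>\<^sup>+x. ennreal (norm (1 / (1 - g x))) \<partial>N) \<le> (\<integral>\<^sup>+x. \<phi> (g x) + 1 \<partial>N)"
    proof (rule nn_integral_mono_AE)
      show "AE x in N. ennreal (norm (1 / (1 - g x))) \<le> \<phi> (g x) + 1"
        using AE1 ae
      proof eventually_elim
        case (elim x)
        have "ennreal (1 / 2) \<le> ennreal 1" by (rule ennreal_leI) simp
        then show ?case using elim by (cases "g x = - 1") (auto simp: \<phi>_def simp del: ennreal_half)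
      qed
    qed
    also have "\<dots> = (\<integral>\<^sup>+x. \<phi> (g x) \<partial>N) + emeasure N (space N)"
      by (subst nn_integral_add) auto
    also have "\<dots> < \<infinity>"
      using fin emeasure_finite[of "space N"] by (simp add: less_top[symmetric])
    finally show "integrable N (\<lambda>x. 1 / (1 - g x)) \<and> (AE x in N. g x \<noteq> 1)"
      using ae by (intro conjI integrableI_bounded) auto
  next
    assume i: "integrable N (\<lambda>x. 1 / (1 - g x)) \<and> (AE x in N. g x \<noteq> 1)"
    have "(\<integral>\<^sup>+x. \<phi> (g x) \<partial>N) \<le> (\<integral>\<^sup>+x. ennreal (norm (1 / (1 - g x))) \<partial>N)"
    proof (rule nn_integral_mono_AE)
      show "AE x in N. \<phi> (g x) \<le> ennreal (norm (1 / (1 - g x)))"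
        using AE1 i[THEN conjunct2] by eventually_elim (auto simp: \<phi>_def)
    qed
    also have "\<dots> < \<infinity>"
      using i by (simp add: integrable_iff_bounded)
    finally show "(\<integral>\<^sup>+x. \<phi> (g x) \<partial>N) \<noteq> \<infinity>" by simp
  qed
  finally show ?thesis .
qed

section \<open>Biorthogonality and the Jacobi matrix\<close>

context perfect_pair
begin

section \<open>Positions of the functions \<open>x^k w_a\<close> in the sequence
  \<open>xi\<close>\<close>

text \<open>Inverse of the map sending \<open>j\<close> to the pair of \<open>a_idx\<close> and
  \<open>k_idx\<close>: the block number and the offset come from dividing \<open>k\<close> by
  \<open>ns a\<close>.\<close>

definition idx_of :: "nat \<Rightarrow> nat \<Rightarrow> nat" where
  "idx_of a k = k div ns a * multi_size p ns + (\<Sum>b=1..<a. ns b) + k mod ns a"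

lemma idx_of:
  assumes "a \<in> {1..p}"
  shows "a_idx p ns (idx_of a k) = a" "k_idx p ns (idx_of a k) = k"
proof -
  have "k div ns a = q_idx p ns (idx_of a k) \<and> a = a_idx p ns (idx_of a k) \<and> k mod ns a = r_idx p ns (idx_of a k)"
    by (subst idx_decomposition[OF ns_pos p_ge_1, symmetric]) (use assms ns_pos in \<open>auto simp: idx_of_def\<close>)
  then show "a_idx p ns (idx_of a k) = a" "k_idx p ns (idx_of a k) = k"
    by (metis, metis k_idx_def div_mult_mod_eq)
qed

lemma a_idx_range: "a_idx p ns j \<in> {1..p}"
  and idx_of_idx: "idx_of (a_idx p ns j) (k_idx p ns j) = j"
proof -
  let ?q = "q_idx p ns j" and ?a = "a_idx p ns j" and ?r = "r_idx p ns j"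
  have d: "j = ?q * multi_size p ns + (\<Sum>b=1..<?a. ns b) + ?r" "?a \<in> {1..p}" "?r < ns ?a"
    using idx_decomposition[where p = p and ns = ns and i = j and q = ?q and a = ?a and r = ?r, OF ns_pos p_ge_1]
    by blast+
  show "a_idx p ns j \<in> {1..p}" by (rule d)
  have "k_idx p ns j div ns ?a = ?q" "k_idx p ns j mod ns ?a = ?r"
    using d(3) by (simp_all add: k_idx_def)
  then show "idx_of (a_idx p ns j) (k_idx p ns j) = j"
    using d(1) by (simp add: idx_of_def)
qed

lemma idx_of_mono:
  assumes a: "a \<in> {1..p}" and "k \<le> k'"
  shows "idx_of a k \<le> idx_of a k'"
proof (rule lift_Suc_mono_le[OF _ assms(2)])
  fix k
  have m: "0 < ns a" using ns_pos a by blast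
  have le: "ns a \<le> multi_size p ns"
    unfolding multi_size_def by (rule member_le_sum) (use a in auto)
  show "idx_of a k \<le> idx_of a (Suc k)"
  proof (cases "Suc (k mod ns a) = ns a")
    case True
    then have "Suc k div ns a = Suc (k div ns a)" "Suc k mod ns a = 0"
      by (simp_all add: div_Suc mod_Suc)
    \<comment> \<open>Entering the next block adds \<open>multi_size p ns\<close> and loses only
      \<open>k mod ns a\<close>.\<close>
    moreover have "k mod ns a \<le> multi_size p ns" using True le by linarith
    ultimately show ?thesis by (simp add: idx_of_def)
  next
    case False
    then have "Suc k div ns a = k div ns a" "Suc k mod ns a = Suc (k mod ns a)"
      by (simp_all add: div_Suc mod_Suc)
    then show ?thesis by (simp add: idx_of_def)
  qed
qed

lemma le_idx_of:
  assumes a: "a \<in> {1..p}"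
  shows "k \<le> idx_of a k"
proof -
  have le: "ns a \<le> multi_size p ns"
    unfolding multi_size_def by (rule member_le_sum) (use a in auto)
  have "k = k div ns a * ns a + k mod ns a" by simp
  also have "\<dots> \<le> idx_of a k"
    unfolding idx_of_def using le by (intro add_mono) (auto intro!: trans_le_add1 mult_left_mono)
  finally show ?thesis .
qed

text \<open>By monotonicity of \<open>idx_of a\<close>, this counts the functions with weight
  \<open>w a\<close> among the first \<open>l\<close> members of \<open>xi\<close>: the multi-index
  of size \<open>l\<close> on the step line determined by \<open>ns\<close>.\<close>

definition multi_idx :: "nat \<Rightarrow> nat \<Rightarrow> nat" where
  "multi_idx l a = (LEAST k. l \<le> idx_of a k)"

lemma less_multi_idx_iff:
  assumes a: "a \<in> {1..p}"
  shows "k < multi_idx l a \<longleftrightarrow> idx_of a k < l"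
proof
  assume "k < multi_idx l a"
  then show "idx_of a k < l"
    unfolding multi_idx_def using not_less_Least not_le by blast
next
  assume k: "idx_of a k < l"
  have "l \<le> idx_of a (multi_idx l a)"
    unfolding multi_idx_def by (rule LeastI[of _ l]) (rule le_idx_of[OF a])
  then show "k < multi_idx l a"
    using k idx_of_mono[OF a] by (meson leD leI le_trans)
qed

text \<open>Sorting the first \<open>l\<close> indices by their weight is a bijection onto the pairs
  \<open>(a, k)\<close> with \<open>k < multi_idx l a\<close>.\<close>

lemma multi_size_multi_idx: "multi_size p (multi_idx l) = l"
proof -
  let ?S = "Sigma {1..p} (\<lambda>a. {..<multi_idx l a})"
  have "bij_betw (\<lambda>j. (a_idx p ns j, k_idx p ns j)) {..<l} ?S"
    by (rule bij_betw_byWitness[where f' = "\<lambda>(a, k). idx_of a k"])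
      (use a_idx_range in \<open>auto simp: idx_of idx_of_idx less_multi_idx_iff\<close>)
  then have "card {..<l} = card ?S" by (rule bij_betw_same_card)
  then show ?thesis by (simp add: multi_size_def)
qed

lemma all_less_idx_iff:
  "(\<forall>j<l. R (a_idx p ns j) (k_idx p ns j)) \<longleftrightarrow> (\<forall>a\<in>{1..p}. \<forall>k<multi_idx l a. R a k)"
  using a_idx_range idx_of_idx idx_of less_multi_idx_iff by metis

section \<open>Type II polynomials and the moment pairing\<close>

abbreviation "B \<equiv> typeII_poly p ns w s M"
abbreviation "Q \<equiv> typeI_form p ns w s M"
abbreviation "J \<equiv> jacobi_matrix p ns w s M"

text \<open>Sorted by weight, the first \<open>l\<close> orthogonality relations are those of the
  multi-index \<open>multi_idx l\<close>, which perfectness makes normal.\<close>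

lemma ex1_typeII:
  "\<exists>!B. degree B = l \<and> lead_coeff B = 1 \<and> (\<forall>j<l. mu_integral s M (\<lambda>x. poly B x * xi p ns w j x) = 0)"
proof -
  have "normal_index p w s M (multi_idx l)"
    using perfect by (simp add: perfect_def)
  moreover have "(\<forall>j<l. mu_integral s M (\<lambda>x. poly B x * xi p ns w j x) = 0) \<longleftrightarrow>
      (\<forall>a\<in>{1..p}. \<forall>k<multi_idx l a. mu_integral s M (\<lambda>x. x ^ k * poly B x * w a x) = 0)" for B
    by (subst all_less_idx_iff[symmetric]) (simp add: xi_def mult_ac)
  ultimately show ?thesis
    unfolding normal_index_def multi_size_multi_idx by simp
qed

lemma degree_B: "degree (B l) = l"
  and lead_coeff_B: "coeff (B l) l = 1"
  and orthogonal_B: "j < l \<Longrightarrow> mu_integral s M (\<lambda>x. poly (B l) x * xi p ns w j x) = 0"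
  using theI'[OF ex1_typeII[of l]] unfolding typeII_poly_def by auto

lemma B_unique:
  assumes "degree f = l" "lead_coeff f = 1"
    "\<And>j. j < l \<Longrightarrow> mu_integral s M (\<lambda>x. poly f x * xi p ns w j x) = 0"
  shows "f = B l"
  unfolding typeII_poly_def by (rule the1_equality[symmetric, OF ex1_typeII]) (use assms in auto)

text \<open>A linear combination of the functions \<open>xi\<close> is encoded by the polynomial with the same
  coefficients.\<close>

definition form :: "real poly \<Rightarrow> real \<Rightarrow> real" where
  "form c x = (\<Sum>j\<le>degree c. coeff c j * xi p ns w j x)"

text \<open>The bilinear form whose matrix in the monomials is the moment matrix.\<close>

definition pairing :: "real poly \<Rightarrow> real poly \<Rightarrow> real" where
  "pairing f c = mu_integral s M (\<lambda>x. poly f x * form c x)"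

lemma form_eq_sum:
  assumes "degree c \<le> n"
  shows "form c x = (\<Sum>j\<le>n. coeff c j * xi p ns w j x)"
  unfolding form_def by (rule sum.mono_neutral_left) (use assms in \<open>auto simp: coeff_eq_0\<close>)

lemma form_add: "form (c + d) x = form c x + form d x"
  using form_eq_sum[of "c + d" "max (degree c) (degree d)"] form_eq_sum[of c "max (degree c) (degree d)"]
    form_eq_sum[of d "max (degree c) (degree d)"]
  by (simp add: degree_add_le_max algebra_simps sum.distrib)

lemma form_smult: "form (smult r c) x = r * form c x"
  using form_eq_sum[of "smult r c" "degree c"]
  by (simp add: form_def degree_smult_le sum_distrib_left mult.assoc)

lemma form_0 [simp]: "form 0 x = 0"
  by (simp add: form_def)

lemma form_sum: "form (\<Sum>i\<in>A. c i) x = (\<Sum>i\<in>A. form (c i) x)"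
  by (induction A rule: infinite_finite_induct) (auto simp: form_add)

lemma form_monom [simp]: "form (monom r j) x = r * xi p ns w j x"
proof (cases "r = 0")
  case False
  have "form (monom r j) x = (\<Sum>i\<le>j. coeff (monom r j) i * xi p ns w i x)"
    by (rule form_eq_sum) (simp add: degree_monom_le)
  also have "\<dots> = (\<Sum>i\<le>j. if i = j then r * xi p ns w i x else 0)"
    by (intro sum.cong) auto
  finally show ?thesis by simp
qed simp

lemma integrable_poly_xi: "integrable M (\<lambda>x. poly f x * xi p ns w j x)"
proof -
  have "integrable M (\<lambda>x. \<Sum>i\<le>degree f. coeff f i * (x ^ (i + k_idx p ns j) * w (a_idx p ns j) x))"
    by (intro Bochner_Integration.integrable_sum integrable_mult_right moments a_idx_range)
  also have "(\<lambda>x. \<Sum>i\<le>degree f. coeff f i * (x ^ (i + k_idx p ns j) * w (a_idx p ns j) x)) =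
      (\<lambda>x. poly f x * xi p ns w j x)"
    by (rule ext) (simp add: poly_altdef xi_def sum_distrib_left sum_distrib_right power_add mult_ac)
  finally show ?thesis .
qed

lemma integrable_poly_form: "integrable M (\<lambda>x. poly f x * form c x)"
proof -
  have "integrable M (\<lambda>x. \<Sum>j\<le>degree c. coeff c j * (poly f x * xi p ns w j x))"
    by (intro Bochner_Integration.integrable_sum integrable_mult_right integrable_poly_xi)
  then show ?thesis
    by (simp add: form_def sum_distrib_left mult_ac)
qed

lemma pairing_add_left: "pairing (f + g) c = pairing f c + pairing g c"
  unfolding pairing_def mu_integral_def poly_add distrib_right
  by (simp add: Bochner_Integration.integral_add integrable_poly_form distrib_left)

lemma pairing_smult_left: "pairing (smult r f) c = r * pairing f c"
  unfolding pairing_def mu_integral_def by (simp add: mult.assoc)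

lemma pairing_0_left [simp]: "pairing 0 c = 0"
  by (simp add: pairing_def mu_integral_def)

lemma pairing_sum_left: "pairing (\<Sum>i\<in>A. f i) c = (\<Sum>i\<in>A. pairing (f i) c)"
  by (induction A rule: infinite_finite_induct) (auto simp: pairing_add_left)

lemma pairing_add_right: "pairing f (c + d) = pairing f c + pairing f d"
  unfolding pairing_def mu_integral_def form_add distrib_left
  by (simp add: Bochner_Integration.integral_add integrable_poly_form distrib_left)

lemma pairing_smult_right: "pairing f (smult r c) = r * pairing f c"
  unfolding pairing_def mu_integral_def form_smult by (simp add: mult.left_commute)

lemma pairing_0_right [simp]: "pairing f 0 = 0"
  by (simp add: pairing_def mu_integral_def)

lemma pairing_diff_right: "pairing f (c - d) = pairing f c - pairing f d"
  using pairing_add_right[of f "c - d" d] by simp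

lemma pairing_sum_right: "pairing f (\<Sum>i\<in>A. c i) = (\<Sum>i\<in>A. pairing f (c i))"
  by (induction A rule: infinite_finite_induct) (auto simp: pairing_add_right)

section \<open>Triangularity of the pairing and dual forms\<close>

lemma pairing_B_monom: "j < l \<Longrightarrow> pairing (B l) (monom 1 j) = 0"
  by (simp add: pairing_def orthogonal_B)

lemma pairing_B_eq_0:
  assumes "degree c < l"
  shows "pairing (B l) c = 0"
proof -
  have "pairing (B l) c = (\<Sum>i\<le>degree c. coeff c i * pairing (B l) (monom 1 i))"
    by (subst poly_as_sum_of_monoms[of c, symmetric])
      (simp add: pairing_sum_right pairing_smult_right[symmetric] smult_monom)
  also have "\<dots> = 0"
    using assms by (intro sum.neutral) (auto simp: pairing_B_monom)
  finally show ?thesis .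
qed

text \<open>If the \<open>l\<close>-th diagonal pairing vanished, then \<open>B (Suc l) + B l\<close> would be a second monic
  polynomial of degree \<open>Suc l\<close> satisfying the orthogonality relations.\<close>

lemma pairing_B_diag_nonzero: "pairing (B l) (monom 1 l) \<noteq> 0"
proof
  assume z: "pairing (B l) (monom 1 l) = 0"
  have d: "degree (B (Suc l) + B l) = Suc l"
    by (subst degree_add_eq_left) (simp_all add: degree_B)
  have "B (Suc l) + B l = B (Suc l)"
  proof (rule B_unique[OF d])
    show "lead_coeff (B (Suc l) + B l) = 1"
      unfolding d using degree_B[of l] by (simp add: lead_coeff_B coeff_eq_0)
    fix j assume "j < Suc l"
    then have "pairing (B (Suc l)) (monom 1 j) = 0" "pairing (B l) (monom 1 j) = 0"
      using z pairing_B_monom by (auto simp: less_Suc_eq)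
    then have "pairing (B (Suc l) + B l) (monom 1 j) = 0"
      by (simp add: pairing_add_left)
    then show "mu_integral s M (\<lambda>x. poly (B (Suc l) + B l) x * xi p ns w j x) = 0"
      by (simp add: pairing_def)
  qed
  then have "B l = 0" by simp
  then show False using lead_coeff_B[of l] by simp
qed

text \<open>Orthogonality removes all terms of \<open>c\<close> below the leading one.\<close>

lemma pairing_B_degree:
  "pairing (B (degree c)) c = lead_coeff c * pairing (B (degree c)) (monom 1 (degree c))"
\<comment> \<open>The constant case is separate: removing the leading term leaves the zero
  polynomial, whose degree is again 0 and does not drop.\<close>
proof (cases "degree c = 0")
  case True
  then obtain r where "c = [:r:]" by (rule degree_eq_zeroE)
  then have "c = smult r (monom 1 0)" by (simp add: monom_0)
  then show ?thesis by (metis True coeff_monom coeff_smult mult.right_neutral pairing_smult_right)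
next
  case False
  let ?m = "monom (lead_coeff c) (degree c)"
  have "degree (c - ?m) < degree c"
  proof (rule le_neq_implies_less)
    show "degree (c - ?m) \<le> degree c"
      by (intro degree_diff_le) (auto simp: degree_monom_le)
    have "coeff (c - ?m) (degree c) = 0" by simp
    then show "degree (c - ?m) \<noteq> degree c"
      using False by (metis degree_0 leading_coeff_0_iff)
  qed
  then have "pairing (B (degree c)) (c - ?m) = 0" by (rule pairing_B_eq_0)
  then show ?thesis
    using pairing_smult_right[of "B (degree c)" "lead_coeff c" "monom 1 (degree c)"]
    by (simp add: pairing_diff_right smult_monom)
qed

text \<open>The polynomial \<open>B (degree c)\<close> detects the leading coefficient of
  \<open>c\<close>.\<close>

lemma pairing_nondegenerate:
  assumes "\<And>l. pairing (B l) c = 0"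
  shows "c = 0"
  using assms[of "degree c"] pairing_B_diag_nonzero by (simp add: pairing_B_degree)

text \<open>Inversion of a triangular matrix with nonzero diagonal, in the manner of
  Gram-Schmidt.\<close>

lemma ex_dual_form: "\<exists>c. degree c \<le> l \<and> (\<forall>i. pairing (B i) c = (if i = l then 1 else 0))"
proof (induction l rule: less_induct)
  case (less l)
  then obtain d where d: "\<And>m. m < l \<Longrightarrow> degree (d m) \<le> m"
    "\<And>m i. m < l \<Longrightarrow> pairing (B i) (d m) = (if i = m then 1 else 0)"
    by metis
  \<comment> \<open>The subtraction removes the pairings with \<open>B m\<close> for
    \<open>m < l\<close>; those with larger index vanish by orthogonality, and \<open>?c\<close>
    normalizes the remaining one.\<close>
  let ?e = "monom 1 l - (\<Sum>m<l. smult (pairing (B m) (monom 1 l)) (d m))"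
  let ?c = "smult (1 / pairing (B l) (monom 1 l)) ?e"
  have deg: "degree ?e \<le> l"
  proof (intro degree_diff_le degree_sum_le)
    fix m assume "m \<in> {..<l}"
    then show "degree (smult (pairing (B m) (monom 1 l)) (d m)) \<le> l"
      using d(1)[of m] degree_smult_le[of _ "d m"] by (meson lessThan_iff le_trans less_imp_le)
  qed (auto simp: degree_monom_le)
  have e: "pairing (B i) ?e = pairing (B i) (monom 1 l) -
      (if i < l then pairing (B i) (monom 1 l) else 0)" for i
  proof -
    have "(\<Sum>m<l. pairing (B m) (monom 1 l) * pairing (B i) (d m)) =
        (\<Sum>m<l. if m = i then pairing (B m) (monom 1 l) else 0)"
      by (intro sum.cong) (auto simp: d(2))
    then show ?thesis
      by (simp add: pairing_diff_right pairing_sum_right pairing_smult_right)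
  qed
  have "pairing (B i) ?c = (if i = l then 1 else 0)" for i
  proof (cases i l rule: linorder_cases)
    case less
    then show ?thesis using e[of i] by (simp add: pairing_smult_right)
  next
    case equal
    then show ?thesis using e[of i] pairing_B_diag_nonzero[of l] by (simp add: pairing_smult_right)
  next
    case greater
    then show ?thesis using e[of i] pairing_B_monom[of l i] by (simp add: pairing_smult_right)
  qed
  moreover have "degree ?c \<le> l" using deg degree_smult_le le_trans by blast
  ultimately show ?case by blast
qed

text \<open>The basis dual to the polynomials \<open>B\<close>; it turns out to hold the
  coefficients of the type I form \<open>Q l\<close>.\<close>

definition dual_form :: "nat \<Rightarrow> real poly" where
  "dual_form l = (SOME c. degree c \<le> l \<and> (\<forall>i. pairing (B i) c = (if i = l then 1 else 0)))"

lemma degree_dual_form: "degree (dual_form l) \<le> l"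
  and pairing_B_dual: "pairing (B i) (dual_form l) = (if i = l then 1 else 0)"
  using someI_ex[OF ex_dual_form[of l]] unfolding dual_form_def by blast+

lemma ex_B_expansion:
  "degree f \<le> d \<Longrightarrow> \<exists>c. f = (\<Sum>m\<le>d. smult (c m) (B m))"
proof (induction d arbitrary: f)
  case 0
  then obtain r where "f = [:r:]" by (auto elim: degree_eq_zeroE)
  moreover obtain r' where r': "B 0 = [:r':]" using degree_B[of 0] by (auto elim: degree_eq_zeroE)
  moreover have "r' = 1" using lead_coeff_B[of 0] r' by simp
  ultimately show ?case by (intro exI[of _ "\<lambda>_. r"]) simp
next
  case (Suc d)
  let ?g = "f - smult (coeff f (Suc d)) (B (Suc d))"
  have "degree ?g \<le> d"
  proof (rule degree_le, intro allI impI)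
    fix i assume i: "d < i"
    show "coeff ?g i = 0"
    proof (cases "i = Suc d")
      case True
      then show ?thesis by (simp add: lead_coeff_B)
    next
      case False
      then show ?thesis using i Suc.prems by (simp add: coeff_eq_0 degree_B)
    qed
  qed
  from Suc.IH[OF this] obtain c where c: "?g = (\<Sum>m\<le>d. smult (c m) (B m))" by blast
  have "f = ?g + smult (coeff f (Suc d)) (B (Suc d))" by simp
  also have "\<dots> = (\<Sum>m\<le>Suc d. smult ((c(Suc d := coeff f (Suc d))) m) (B m))"
    unfolding c by (auto intro!: sum.cong)
  finally show ?case by blast
qed

lemma pairing_B_sum_dual:
  "finite A \<Longrightarrow> pairing (\<Sum>m\<in>A. smult (c m) (B m)) (dual_form j) = (if j \<in> A then c j else 0)"
  by (simp add: pairing_sum_left pairing_smult_left pairing_B_dual if_distrib[of "\<lambda>y. _ * y"] cong: if_cong)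

text \<open>Pairing with the dual forms reads off the coefficients of any expansion in the
  \<open>B m\<close>.\<close>

lemma B_expansion:
  assumes "degree f \<le> d"
  shows "f = (\<Sum>m\<le>d. smult (pairing f (dual_form m)) (B m))"
proof -
  obtain c where c: "f = (\<Sum>m\<le>d. smult (c m) (B m))" using ex_B_expansion[OF assms] by blast
  have "pairing f (dual_form m) = c m" if "m \<le> d" for m
    using that by (subst c) (simp add: pairing_B_sum_dual)
  then show ?thesis by (subst c) (auto intro!: sum.cong)
qed

lemma pairing_dual_eq_0:
  assumes "degree f < j"
  shows "pairing f (dual_form j) = 0"
  by (subst B_expansion[OF order.refl]) (use assms in \<open>simp add: pairing_B_sum_dual\<close>)

section \<open>The Jacobi matrix and the type I forms in terms of the dual basis\<close>

text \<open>The dual forms give both halves of the definite description: they supply an expansion of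
  \<open>x B n\<close> and determine the coefficients of every other one.\<close>

lemma jacobi_matrix_eq: "J n m = pairing ([:0, 1:] * B n) (dual_form m)"
proof -
  let ?f = "[:0, 1:] * B n"
  let ?c = "\<lambda>m. pairing ?f (dual_form m)"
  have fin: "{m. ?c m \<noteq> 0} \<subseteq> {..degree ?f}"
    using pairing_dual_eq_0[of ?f] by (auto simp: not_less[symmetric])
  have "J n = ?c"
    unfolding jacobi_matrix_def
  proof (rule the_equality, intro conjI)
    show "finite {m. ?c m \<noteq> 0}" using fin finite_subset by blast
    have "?f = (\<Sum>m\<le>degree ?f. smult (?c m) (B m))" by (rule B_expansion) simp
    also have "\<dots> = (\<Sum>m | ?c m \<noteq> 0. smult (?c m) (B m))"
      by (rule sum.mono_neutral_right) (use fin in auto)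
    finally show "?f = (\<Sum>m | ?c m \<noteq> 0. smult (?c m) (B m))" .
  next
    fix c assume c: "finite {m. c m \<noteq> 0} \<and> ?f = (\<Sum>m | c m \<noteq> 0. smult (c m) (B m))"
    show "c = ?c"
    proof
      fix m
      have "?c m = pairing (\<Sum>m | c m \<noteq> 0. smult (c m) (B m)) (dual_form m)"
        using c by simp
      also have "\<dots> = c m" using c by (subst pairing_B_sum_dual) auto
      finally show "c m = ?c m" by simp
    qed
  qed
  then show ?thesis by simp
qed

lemma jacobi_matrix_eq_0: "Suc n < m \<Longrightarrow> J n m = 0"
  unfolding jacobi_matrix_eq
  by (rule pairing_dual_eq_0) (simp add: degree_mult_le degree_B order.strict_trans1[OF degree_mult_le])

lemma B_recurrence: "[:0, 1:] * B n = (\<Sum>m\<le>Suc n. smult (J n m) (B m))"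
  unfolding jacobi_matrix_eq
  by (rule B_expansion) (use degree_mult_le[of "[:0, 1:]" "B n"] in \<open>simp add: degree_B\<close>)

text \<open>A monomial of degree below \<open>l\<close> pairs to zero with
  \<open>dual_form l\<close>, and \<open>x^l\<close> differs from the monic \<open>B l\<close> only
  in such lower terms.\<close>

lemma pairing_dual_monom:
  assumes "i \<le> l"
  shows "pairing (monom 1 i) (dual_form l) = (if i = l then 1 else 0)"
proof (cases "i = l")
  case False
  then show ?thesis using assms by (simp add: pairing_dual_eq_0 degree_monom_eq)
next
  case True
  have "pairing (monom 1 l) (dual_form l) = pairing (B l) (dual_form l)"
  \<comment> \<open>For \<open>l = 0\<close> no degree is smaller, but there the monomial equals
    \<open>B 0\<close>.\<close>
  proof (cases l)
    case 0
    obtain r where "B 0 = [:r:]" using degree_B[of 0] by (auto elim: degree_eq_zeroE)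
    then show ?thesis using lead_coeff_B[of 0] by (simp add: 0 monom_0)
  next
    case (Suc k)
    have "degree (monom 1 l - B l) \<le> k"
    proof (rule degree_le, intro allI impI)
      fix i assume "k < i"
      then show "coeff (monom 1 l - B l) i = 0"
        using Suc lead_coeff_B[of l] by (cases "i = l") (auto simp: coeff_eq_0 degree_B)
    qed
    then have "pairing (monom 1 l - B l) (dual_form l) = 0"
      by (intro pairing_dual_eq_0) (simp add: Suc)
    then show ?thesis
      using pairing_add_left[of "monom 1 l - B l" "B l" "dual_form l"] by simp
  qed
  then show ?thesis using True by (simp add: pairing_B_dual)
qed

text \<open>A competitor has the same pairings with every \<open>B i\<close> as the dual form: for
  \<open>i \<le> l\<close> through the prescribed moments, for \<open>i > l\<close> by degree.
  Nondegeneracy then gives equal coefficients.\<close>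

lemma typeI_form_eq: "Q l = form (dual_form l)"
  unfolding typeI_form_def
proof (rule the_equality, intro conjI allI impI)
  show "\<exists>c. form (dual_form l) = (\<lambda>x. \<Sum>j\<le>l. c j * xi p ns w j x)"
    using form_eq_sum[OF degree_dual_form[of l]] by blast
  show "mu_integral s M (\<lambda>x. x ^ i * form (dual_form l) x) = (if i = l then 1 else 0)" if "i \<le> l" for i
    using pairing_dual_monom[OF that] by (simp add: pairing_def poly_monom)
next
  fix G assume G: "(\<exists>c. G = (\<lambda>x. \<Sum>j\<le>l. c j * xi p ns w j x)) \<and>
    (\<forall>i\<le>l. mu_integral s M (\<lambda>x. x ^ i * G x) = (if i = l then 1 else 0))"
  then obtain c where c: "G = (\<lambda>x. \<Sum>j\<le>l. c j * xi p ns w j x)" by blast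
  define g where "g = (\<Sum>j\<le>l. monom (c j) j)"
  have Gg: "G = form g" by (auto simp: c g_def form_sum)
  have degg: "degree g \<le> l"
    unfolding g_def by (rule degree_sum_le) (auto intro: order.trans[OF degree_monom_le])
  have "g - dual_form l = 0"
  proof (rule pairing_nondegenerate)
    fix i
    show "pairing (B i) (g - dual_form l) = 0"
    proof (cases "i \<le> l")
      case True
      have m: "pairing (monom 1 k) (g - dual_form l) = 0" if "k \<le> l" for k
      proof -
        have "pairing (monom 1 k) g = (if k = l then 1 else 0)"
          using G that by (simp add: pairing_def Gg poly_monom)
        then show ?thesis using pairing_dual_monom[OF that] by (simp add: pairing_diff_right)
      qed
      have "pairing (B i) (g - dual_form l) =
          (\<Sum>k\<le>degree (B i). coeff (B i) k * pairing (monom 1 k) (g - dual_form l))"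
        by (subst poly_as_sum_of_monoms[of "B i", symmetric])
          (simp add: pairing_sum_left pairing_smult_left[symmetric] smult_monom)
      also have "\<dots> = 0"
        using True by (intro sum.neutral) (auto simp: degree_B m)
      finally show ?thesis .
    next
      case False
      then show ?thesis
        using degree_diff_le[OF degg degree_dual_form] by (intro pairing_B_eq_0) simp
    qed
  qed
  then show "G = form (dual_form l)" by (simp add: Gg)
qed

section \<open>The transposed recurrence and the initial element\<close>

text \<open>Multiplication by \<open>x\<close> keeps the weight and raises the power by one, so it
  maps each \<open>xi\<close> to another \<open>xi\<close>.\<close>

lemma ex_form_times_x: "\<exists>d. \<forall>x. form d x = x * form c x"
proof -
  let ?d = "\<Sum>j\<le>degree c. monom (coeff c j) (idx_of (a_idx p ns j) (Suc (k_idx p ns j)))"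
  have "form ?d x = x * form c x" for x
    unfolding form_sum form_monom unfolding form_def sum_distrib_left
    by (intro sum.cong) (auto simp: xi_def idx_of[OF a_idx_range])
  then show ?thesis by blast
qed

text \<open>Let \<open>d\<close> represent \<open>x Q n\<close>. Its pairings with
  \<open>B m\<close> are the entries \<open>J m n\<close>, which vanish beyond the degree of
  \<open>d\<close>, so \<open>d\<close> is the corresponding combination of dual forms. As
  coefficients are compared, the recurrence holds at every point and may be evaluated outside
  \<open>\<Delta>\<close>.\<close>

lemma ex_Q_recurrence:
  "\<exists>N. (\<forall>m>N. J m n = 0) \<and> (\<forall>x. x * Q n x = (\<Sum>m\<le>N. J m n * Q m x)) \<and>
     (\<forall>f. pairing ([:0, 1:] * f) (dual_form n) = (\<Sum>m\<le>N. J m n * pairing f (dual_form m)))"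
proof -
  obtain d where d: "\<And>x. form d x = x * form (dual_form n) x"
    using ex_form_times_x by blast
  have pd: "pairing f d = pairing ([:0, 1:] * f) (dual_form n)" for f
    by (simp add: pairing_def d mult_ac)
  have Jd: "J m n = pairing (B m) d" for m
    by (simp add: pd jacobi_matrix_eq)
  let ?N = "degree d"
  have 0: "J m n = 0" if "?N < m" for m
    unfolding Jd by (rule pairing_B_eq_0[OF that])
  have "d - (\<Sum>m\<le>?N. smult (J m n) (dual_form m)) = 0"
  proof (rule pairing_nondegenerate)
    fix i
    have "(\<Sum>m\<le>?N. J m n * pairing (B i) (dual_form m)) = (\<Sum>m\<le>?N. if m = i then J m n else 0)"
      by (intro sum.cong) (auto simp: pairing_B_dual)
    then show "pairing (B i) (d - (\<Sum>m\<le>?N. smult (J m n) (dual_form m))) = 0"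
      using 0[of i] by (simp add: pairing_diff_right pairing_sum_right pairing_smult_right Jd[symmetric] not_less[symmetric])
  qed
  then have e: "d = (\<Sum>m\<le>?N. smult (J m n) (dual_form m))" by simp
  have "x * Q n x = (\<Sum>m\<le>?N. J m n * Q m x)" for x
    unfolding typeI_form_eq d[symmetric] by (subst e) (simp add: form_sum form_smult)
  moreover have "pairing ([:0, 1:] * f) (dual_form n) = (\<Sum>m\<le>?N. J m n * pairing f (dual_form m))" for f
    unfolding pd[symmetric] by (subst e) (simp add: pairing_sum_right pairing_smult_right)
  ultimately show ?thesis using 0 by blast
qed

lemma idx_0: "a_idx p ns 0 = 1" "k_idx p ns 0 = 0"
proof -
  have "0 = q_idx p ns 0 \<and> 1 = a_idx p ns 0 \<and> 0 = r_idx p ns 0"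
    by (subst idx_decomposition[OF ns_pos p_ge_1, symmetric]) (use p_ge_1 ns_pos in auto)
  then show "a_idx p ns 0 = 1" "k_idx p ns 0 = 0" by (auto simp: k_idx_def)
qed

lemma B_0: "B 0 = 1"
proof -
  obtain r where "B 0 = [:r:]" using degree_B[of 0] by (auto elim: degree_eq_zeroE)
  then show ?thesis using lead_coeff_B[of 0] by (simp add: one_pCons)
qed

text \<open>Up to the sign \<open>s\<close> this is the first diagonal pairing.\<close>

lemma integral_w1_nonzero: "(\<integral>x. w 1 x \<partial>M) \<noteq> 0"
proof -
  have "pairing (B 0) (monom 1 0) = s * (\<integral>x. w 1 x \<partial>M)"
    unfolding pairing_def form_monom mu_integral_def by (simp add: B_0 xi_def idx_0)
  then show ?thesis using pairing_B_diag_nonzero[of 0] by auto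
qed

lemma form_dual_0: "form (dual_form 0) x = w 1 x / mu_integral s M (w 1)"
proof -
  obtain r where r: "dual_form 0 = monom r 0"
    using degree_dual_form[of 0] by (auto simp: monom_0 elim: degree_eq_zeroE)
  have "1 = pairing (B 0) (dual_form 0)" by (simp add: pairing_B_dual)
  also have "\<dots> = r * mu_integral s M (w 1)"
    by (simp add: pairing_def r mu_integral_def B_0 xi_def idx_0)
  finally have "r * mu_integral s M (w 1) = 1" by simp
  then have "r = 1 / mu_integral s M (w 1)"
    by (metis mult_zero_right nonzero_eq_divide_eq zero_neq_one)
  then show ?thesis by (simp add: r xi_def idx_0)
qed

end

section \<open>The two dual chains\<close>

text \<open>An element at \<open>x \<ge> lam\<close> would force \<open>x\<close>,
  \<open>lam\<close> and the bound to coincide, and the bound is not attained at this point.\<close>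

lemma abs_bound_no_zero_beyond:
  fixes Z :: "'a :: real_normed_algebra_1 set"
  assumes le: "abs_bound Z \<le> ereal lam" and notin: "of_real (real_of_ereal (abs_bound Z)) \<notin> Z"
    and x: "lam \<le> x"
  shows "of_real x \<notin> Z"
proof
  assume z: "of_real x \<in> Z"
  have b: "ereal \<bar>x\<bar> \<le> abs_bound Z"
    using z unfolding abs_bound_def by (metis SUP_upper norm_of_real)
  then have "ereal \<bar>x\<bar> \<le> ereal lam" using le by (rule order.trans)
  then have "\<bar>x\<bar> = x" "lam = x" using x by auto
  then have "abs_bound Z = ereal x" using b le by (intro antisym) auto
  then show False using notin z by simp
qed

context perfect_pair
begin

section \<open>The normalized measure \<open>w_1 d\<mu>\<close> and its moments\<close>

lemma space_M: "space M = \<Delta>"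
  using sets_eq_imp_space_eq[OF sets_M] by (simp add: space_restrict_space)

lemma measurable_ident_M [measurable]: "(\<lambda>x. x) \<in> borel_measurable M"
  unfolding measurable_cong_sets[OF sets_M refl]
  by (rule measurable_restrict_space1) simp

lemma measurable_w1 [measurable]: "w 1 \<in> borel_measurable M"
  using borel_measurable_integrable[OF moments[of 1 0]] p_ge_1 by simp

text \<open>Dividing by the integral cancels the sign of the weight and yields a probability
  density.\<close>

definition w1_density :: "real \<Rightarrow> real" where
  "w1_density x = w 1 x / (\<integral>x. w 1 x \<partial>M)"

lemma measurable_w1_density [measurable]: "w1_density \<in> borel_measurable M"
  unfolding w1_density_def by measurable

lemma w1_density_nonneg: "x \<in> \<Delta> \<Longrightarrow> 0 \<le> w1_density x"
proof -
  assume x: "x \<in> \<Delta>"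
  consider "\<forall>x\<in>\<Delta>. 0 \<le> w 1 x" | "\<forall>x\<in>\<Delta>. w 1 x \<le> 0"
    using weight_sign[of 1] p_ge_1 by auto
  then show ?thesis
  proof cases
    case 1
    then have "0 \<le> (\<integral>x. w 1 x \<partial>M)"
      by (intro Bochner_Integration.integral_nonneg) (simp add: space_M)
    then show ?thesis using 1 x by (simp add: w1_density_def)
  next
    case 2
    then have "0 \<le> (\<integral>x. - w 1 x \<partial>M)"
      by (intro Bochner_Integration.integral_nonneg) (simp add: space_M)
    then show ?thesis using 2 x by (simp add: w1_density_def divide_nonpos_nonpos)
  qed
qed

lemma AE_w1_density_nonneg: "AE x in M. 0 \<le> w1_density x"
  by (rule AE_I2) (simp add: space_M w1_density_nonneg)

lemma integrable_w1_density: "integrable M (\<lambda>x. w1_density x * x ^ n)"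
proof -
  have "integrable M (\<lambda>x. x ^ n * w 1 x / (\<integral>x. w 1 x \<partial>M))"
    by (intro integrable_divide moments) (use p_ge_1 in auto)
  then show ?thesis by (simp add: w1_density_def mult.commute)
qed

text \<open>The nonzero normalizing constant does not affect integrability, and the absence of an
  atom at \<open>lam\<close> is the statement that \<open>x \<noteq> lam\<close> almost
  everywhere.\<close>

lemma markov_integral_converges_iff:
  "markov_integral_converges (w 1) M lam \<longleftrightarrow>
    integrable (density M w1_density) (\<lambda>x. 1 / (1 - x / lam)) \<and> (AE x in density M w1_density. x \<noteq> lam)"
proof -
  have "integrable (density M w1_density) (\<lambda>x. 1 / (1 - x / lam)) \<longleftrightarrow>
      integrable M (\<lambda>x. w1_density x *\<^sub>R (1 / (1 - x / lam)))"
    by (rule integrable_density) (use AE_w1_density_nonneg in measurable)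
  also have "(\<lambda>x. w1_density x *\<^sub>R (1 / (1 - x / lam))) = (\<lambda>x. (w 1 x / (1 - x / lam)) / (\<integral>x. w 1 x \<partial>M))"
    by (auto simp: w1_density_def)
  also have "integrable M \<dots> \<longleftrightarrow> integrable M (\<lambda>x. w 1 x / (1 - x / lam))"
  proof
    assume "integrable M (\<lambda>x. w 1 x / (1 - x / lam) / (\<integral>x. w 1 x \<partial>M))"
    from integrable_mult_left[OF this, of "\<integral>x. w 1 x \<partial>M"] show "integrable M (\<lambda>x. w 1 x / (1 - x / lam))"
      using integral_w1_nonzero by simp
  qed (rule integrable_divide)
  finally have 1: "integrable (density M w1_density) (\<lambda>x. 1 / (1 - x / lam)) \<longleftrightarrow>
      integrable M (\<lambda>x. w 1 x / (1 - x / lam))" .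
  have "(AE x in density M w1_density. x \<noteq> lam) \<longleftrightarrow> (AE x in M. 0 < w1_density x \<longrightarrow> x \<noteq> lam)"
    by (subst AE_density) auto
  also have "\<dots> \<longleftrightarrow> \<not> (0 < emeasure M {lam} \<and> w 1 lam \<noteq> 0)"
  proof (cases "lam \<in> \<Delta> \<and> 0 < w1_density lam")
    case True
    have "{lam} = (\<lambda>x. x) -` {lam} \<inter> space M" using True by (auto simp: space_M)
    then have m: "{lam} \<in> sets M" using measurable_sets[OF measurable_ident_M, of "{lam}"] by simp
    have "(AE x in M. 0 < w1_density x \<longrightarrow> x \<noteq> lam) \<longleftrightarrow> emeasure M {lam} = 0"
      by (rule AE_iff_measurable[OF m]) (use True in \<open>auto simp: space_M\<close>)
    moreover have "w 1 lam \<noteq> 0" using True by (auto simp: w1_density_def)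
    ultimately show ?thesis by (simp add: zero_less_iff_neq_zero)
  next
    case False
    then have "AE x in M. 0 < w1_density x \<longrightarrow> x \<noteq> lam"
      by (intro AE_I2) (auto simp: space_M)
    moreover have "emeasure M {lam} = 0 \<or> w 1 lam = 0"
    proof (cases "lam \<in> \<Delta>")
      case True
      then have "w1_density lam = 0" using False w1_density_nonneg[OF True] by simp
      then show ?thesis using integral_w1_nonzero by (simp add: w1_density_def)
    next
      case False
      \<comment> \<open>Outside \<open>\<Delta>\<close> the singleton is not measurable, and
        \<open>emeasure\<close> is 0 there by convention.\<close>
      then have "{lam} \<notin> sets M" using sets.sets_into_space[of "{lam}" M] by (auto simp: space_M)
      then show ?thesis by (simp add: emeasure_notin_sets)
    qed
    ultimately show ?thesis by auto
  qed
  finally show ?thesis using 1 by (simp add: markov_integral_converges_def)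
qed

lemma pairing_power_0:
  "pairing ([:0, 1:] ^ n) (dual_form 0) / lam ^ n = (\<integral>x. (x / lam) ^ n \<partial>density M w1_density)"
proof -
  have "(\<integral>x. (x / lam) ^ n \<partial>density M w1_density) = (\<integral>x. w1_density x *\<^sub>R (x / lam) ^ n \<partial>M)"
    by (rule integral_density) (use AE_w1_density_nonneg in measurable)
  also have "\<dots> = (\<integral>x. (x ^ n * w1_density x) / lam ^ n \<partial>M)"
    by (simp add: power_divide mult.commute)
  also have "\<dots> = (\<integral>x. x ^ n * w1_density x \<partial>M) / lam ^ n"
    by simp
  \<comment> \<open>The sign \<open>s\<close> occurs in the pairing and in the normalization of
    \<open>Q 0\<close>, and cancels.\<close>
  also have "(\<integral>x. x ^ n * w1_density x \<partial>M) = pairing ([:0, 1:] ^ n) (dual_form 0)"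
    using sign by (auto simp: pairing_def mu_integral_def form_dual_0 w1_density_def)
  finally show ?thesis by simp
qed

text \<open>The moment criterion for \<open>x / lam\<close>; being probabilities, the
  \<open>u n\<close> supply its bounds.\<close>

lemma summable_return_iff:
  assumes lam: "0 < lam"
    and u: "\<And>n. u n = pairing ([:0, 1:] ^ n) (dual_form 0) / lam ^ n"
    and u0: "\<And>n. 0 \<le> u n" and u1: "\<And>n. u n \<le> 1"
  shows "summable u \<longleftrightarrow> markov_integral_converges (w 1) M lam"
proof -
  let ?N = "density M w1_density"
  have u': "u n = (\<integral>x. (x / lam) ^ n \<partial>?N)" for n
    unfolding u by (rule pairing_power_0)
  have int: "integrable ?N (\<lambda>x. (x / lam) ^ n)" for n
  proof (subst integrable_density)
    show "integrable M (\<lambda>x. w1_density x *\<^sub>R (x / lam) ^ n)"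
      using integrable_divide[OF integrable_w1_density[of n], of "lam ^ n"] by (simp add: power_divide)
  qed (use AE_w1_density_nonneg in measurable)
  \<comment> \<open>The zeroth moment shows that the measure is finite.\<close>
  have "integrable ?N (\<lambda>x. 1 :: real)" using int[of 0] by simp
  then have "finite_measure ?N"
    by (intro finite_measureI) (simp add: integrable_iff_bounded less_top)
  then have "summable (\<lambda>n. \<integral>x. (x / lam) ^ n \<partial>?N) \<longleftrightarrow>
      integrable ?N (\<lambda>x. 1 / (1 - x / lam)) \<and> (AE x in ?N. x / lam \<noteq> 1)"
  proof (rule summable_moments_iff)
    show "(\<lambda>x. x / lam) \<in> borel_measurable ?N" by simp measurable
  qed (use int u0 u1 u' in auto)
  moreover have "x / lam \<noteq> 1 \<longleftrightarrow> x \<noteq> lam" for x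
    using lam by auto
  ultimately show ?thesis
    unfolding markov_integral_converges_iff by (simp only: u'[abs_def])
qed

section \<open>Stochasticity and the powers of the transition matrices\<close>

lemma P_II_eq:
  "P_II lam p ns w s M i j = J i j * poly (B j) lam / (lam * poly (B i) lam)"
  by (simp add: P_II_def scaled_conjugate_def)

lemma P_I_eq: "P_I lam p ns w s M i j = J j i * Q j lam / (lam * Q i lam)"
  by (simp add: P_I_def scaled_conjugate_def)

text \<open>The row sums are the recurrence of the \<open>B n\<close> evaluated at
  \<open>lam\<close>.\<close>

lemma stochastic_P_II:
  assumes J: "\<And>n m. 0 \<le> J n m" and lam: "0 < lam" and pos: "\<And>n. 0 < poly (B n) lam"
  shows "stochastic (P_II lam p ns w s M)"
  unfolding stochastic_def
proof (intro conjI allI)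
  fix i j
  show "0 \<le> P_II lam p ns w s M i j"
    unfolding P_II_eq
    by (intro divide_nonneg_pos mult_nonneg_nonneg mult_pos_pos J lam pos less_imp_le[OF pos])
next
  fix i
  have "P_II lam p ns w s M i sums (\<Sum>m\<le>Suc i. P_II lam p ns w s M i m)"
    by (rule sums_finite) (auto simp: P_II_eq jacobi_matrix_eq_0)
  also have "(\<Sum>m\<le>Suc i. P_II lam p ns w s M i m) = (\<Sum>m\<le>Suc i. J i m * poly (B m) lam) / (lam * poly (B i) lam)"
    unfolding P_II_eq sum_divide_distrib ..
  also have "(\<Sum>m\<le>Suc i. J i m * poly (B m) lam) = lam * poly (B i) lam"
    using arg_cong[OF B_recurrence[of i], of "\<lambda>f. poly f lam"] by (simp add: poly_sum)
  also have "lam * poly (B i) lam / (lam * poly (B i) lam) = 1"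
    using lam pos[of i] by simp
  finally show "P_II lam p ns w s M i sums 1" .
qed

text \<open>The row sums are the transposed recurrence of the \<open>Q n\<close> evaluated at
  \<open>lam\<close>.\<close>

lemma stochastic_P_I:
  assumes J: "\<And>n m. 0 \<le> J n m" and lam: "0 < lam" and pos: "\<And>n. 0 < Q n lam"
  shows "stochastic (P_I lam p ns w s M)"
  unfolding stochastic_def
proof (intro conjI allI)
  fix i j
  show "0 \<le> P_I lam p ns w s M i j"
    unfolding P_I_eq
    by (intro divide_nonneg_pos mult_nonneg_nonneg mult_pos_pos J lam pos less_imp_le[OF pos])
next
  fix i
  obtain N where N: "\<forall>m>N. J m i = 0" "\<forall>x. x * Q i x = (\<Sum>m\<le>N. J m i * Q m x)"
    using ex_Q_recurrence by blast
  have "P_I lam p ns w s M i sums (\<Sum>m\<le>N. P_I lam p ns w s M i m)"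
    by (rule sums_finite) (auto simp: P_I_eq N)
  also have "(\<Sum>m\<le>N. P_I lam p ns w s M i m) = (\<Sum>m\<le>N. J m i * Q m lam) / (lam * Q i lam)"
    unfolding P_I_eq sum_divide_distrib ..
  also have "(\<Sum>m\<le>N. J m i * Q m lam) = lam * Q i lam"
    using N(2) by simp
  also have "lam * Q i lam / (lam * Q i lam) = 1"
    using lam pos[of i] by simp
  finally show "P_I lam p ns w s M i sums 1" .
qed

text \<open>The diagonal factors telescope in the powers, and the pairing is the entry
  \<open>(i, j)\<close> of the \<open>n\<close>-th power of \<open>J\<close>: each further step
  multiplies \<open>B i\<close> by \<open>x\<close>.\<close>

lemma step_prob_P_II:
  assumes st: "stochastic (P_II lam p ns w s M)"
    and lam: "0 < lam" and pos: "\<And>n. 0 < poly (B n) lam"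
  shows "stochastic_matrix.step_prob (P_II lam p ns w s M) n i j =
    pairing ([:0, 1:] ^ n * B i) (dual_form j) * poly (B j) lam / (lam ^ n * poly (B i) lam)"
proof (induction n arbitrary: i)
  interpret stochastic_matrix "P_II lam p ns w s M" by unfold_locales (rule st)
  {
    case 0
    show ?case using pos[of i] by (auto simp: step_prob_0 pairing_B_dual)
  next
    case (Suc n)
    let ?u = "\<lambda>k. pairing ([:0, 1:] ^ n * B k) (dual_form j)"
    have "(\<lambda>k. P_II lam p ns w s M i k * step_prob n k j) sums
        (\<Sum>k\<le>Suc i. P_II lam p ns w s M i k * step_prob n k j)"
      by (rule sums_finite) (auto simp: P_II_eq jacobi_matrix_eq_0)
    then have "step_prob (Suc n) i j = (\<Sum>k\<le>Suc i. P_II lam p ns w s M i k * step_prob n k j)"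
      using step_prob_Suc sums_unique2 by blast
    also have "\<dots> = (\<Sum>k\<le>Suc i. J i k * ?u k * (poly (B j) lam / (lam ^ Suc n * poly (B i) lam)))"
    proof (rule sum.cong[OF refl])
      fix k
      show "P_II lam p ns w s M i k * step_prob n k j =
          J i k * ?u k * (poly (B j) lam / (lam ^ Suc n * poly (B i) lam))"
        using lam pos[of i] pos[of k] unfolding Suc P_II_eq by (simp add: field_simps)
    qed
    also have "\<dots> = (\<Sum>k\<le>Suc i. J i k * ?u k) * (poly (B j) lam / (lam ^ Suc n * poly (B i) lam))"
      by (rule sum_distrib_right[symmetric])
    also have "(\<Sum>k\<le>Suc i. J i k * ?u k) = pairing ([:0, 1:] ^ n * ([:0, 1:] * B i)) (dual_form j)"
      unfolding B_recurrence by (simp only: sum_distrib_left pairing_sum_left mult_smult_right pairing_smult_left)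
    also have "[:0, 1:] ^ n * ([:0, 1:] * B i) = [:0, 1:] ^ Suc n * B i"
      by (simp only: power_Suc mult_ac)
    finally show ?case by simp
  }
qed

text \<open>The entry \<open>(j, i)\<close> of the same power appears; here the extra factor
  \<open>x\<close> is absorbed on the side of the dual form.\<close>

lemma step_prob_P_I:
  assumes st: "stochastic (P_I lam p ns w s M)"
    and lam: "0 < lam" and pos: "\<And>n. 0 < Q n lam"
  shows "stochastic_matrix.step_prob (P_I lam p ns w s M) n i j =
    pairing ([:0, 1:] ^ n * B j) (dual_form i) * Q j lam / (lam ^ n * Q i lam)"
proof (induction n arbitrary: i)
  interpret stochastic_matrix "P_I lam p ns w s M" by unfold_locales (rule st)
  {
    case 0
    show ?case using pos[of i] by (auto simp: step_prob_0 pairing_B_dual)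
  next
    case (Suc n)
    let ?f = "[:0, 1:] ^ n * B j"
    obtain N where N: "\<forall>m>N. J m i = 0"
      "\<forall>f. pairing ([:0, 1:] * f) (dual_form i) = (\<Sum>m\<le>N. J m i * pairing f (dual_form m))"
      using ex_Q_recurrence by blast
    have "(\<lambda>k. P_I lam p ns w s M i k * step_prob n k j) sums
        (\<Sum>k\<le>N. P_I lam p ns w s M i k * step_prob n k j)"
      by (rule sums_finite) (auto simp: P_I_eq N)
    then have "step_prob (Suc n) i j = (\<Sum>k\<le>N. P_I lam p ns w s M i k * step_prob n k j)"
      using step_prob_Suc sums_unique2 by blast
    also have "\<dots> = (\<Sum>k\<le>N. J k i * pairing ?f (dual_form k) * (Q j lam / (lam ^ Suc n * Q i lam)))"
    proof (rule sum.cong[OF refl])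
      fix k
      show "P_I lam p ns w s M i k * step_prob n k j =
          J k i * pairing ?f (dual_form k) * (Q j lam / (lam ^ Suc n * Q i lam))"
        using lam pos[of i] pos[of k] unfolding Suc P_I_eq by (simp add: field_simps)
    qed
    also have "\<dots> = (\<Sum>k\<le>N. J k i * pairing ?f (dual_form k)) * (Q j lam / (lam ^ Suc n * Q i lam))"
      by (rule sum_distrib_right[symmetric])
    also have "(\<Sum>k\<le>N. J k i * pairing ?f (dual_form k)) = pairing ([:0, 1:] * ?f) (dual_form i)"
      using N(2) by simp
    also have "[:0, 1:] * ?f = [:0, 1:] ^ Suc n * B j"
      by (simp only: power_Suc mult_ac)
    finally show ?case by simp
  }
qed

section \<open>Positivity at and beyond \<open>lam\<close>\<close>

text \<open>A monic polynomial is positive far to the right, so a negative value at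
  \<open>lam\<close> would produce a zero beyond \<open>lam\<close>.\<close>

lemma poly_B_pos:
  assumes "\<And>x. lam \<le> x \<Longrightarrow> poly (B n) x \<noteq> 0"
  shows "0 < poly (B n) lam"
proof (rule ccontr)
  assume "\<not> 0 < poly (B n) lam"
  then have neg: "poly (B n) lam < 0" using assms[of lam] by simp
  have "lead_coeff (B n) > 0" by (simp add: degree_B lead_coeff_B)
  from poly_pinfty_gt_lc[OF this] obtain r where r: "\<And>x. r \<le> x \<Longrightarrow> 1 \<le> poly (B n) x"
    by (auto simp: degree_B lead_coeff_B)
  have "0 < poly (B n) (max r (lam + 1))" using r[of "max r (lam + 1)"] by simp
  from poly_IVT_pos[OF _ neg this] assms show False by fastforce
qed

lemma continuous_on_Q: "continuous_on I (Q n)"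
  unfolding typeI_form_eq form_def[abs_def] xi_def
  by (intro continuous_intros weight_continuous a_idx_range)

lemma atLeast_subset_I: "lam \<in> I \<Longrightarrow> lam \<le> x \<Longrightarrow> x \<in> I"
  using I_unbounded interval_I
  by (meson bdd_above.unfold is_interval_1 linear)

text \<open>The same argument, with the limit at infinity in place of the leading coefficient and
  continuity of the weights on \<open>I\<close>.\<close>

lemma Q_pos:
  assumes nz: "\<And>x. lam \<le> x \<Longrightarrow> Q n x \<noteq> 0" and lam: "lam \<in> I"
    and lim: "filterlim (Q n) at_top at_top"
  shows "0 < Q n lam"
proof (rule ccontr)
  assume "\<not> 0 < Q n lam"
  then have neg: "Q n lam \<le> 0" by simp
  have "eventually (\<lambda>x. 0 \<le> Q n x \<and> lam \<le> x) at_top"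
    using lim[unfolded filterlim_at_top] by (intro eventually_conj eventually_ge_at_top) blast
  then obtain y where y: "0 \<le> Q n y" "lam \<le> y"
    by (auto simp: eventually_at_top_linorder)
  have "continuous_on {lam..y} (Q n)"
    by (rule continuous_on_subset[OF continuous_on_Q]) (use atLeast_subset_I[OF lam] in auto)
  from IVT'[OF neg y this] nz show False by blast
qed

text \<open>Ensures that the zero set of the \<open>B n\<close> is nonempty, from which
  \<open>lam > 0\<close> follows.\<close>

lemma ex_zero_B_1: "\<exists>x. poly (B 1) x = 0"
proof -
  have "coeff (B 1) 1 = 1" by (rule lead_coeff_B)
  then have "poly (B 1) (- coeff (B 1) 0) = 0"
    by (simp add: poly_altdef degree_B)
  then show ?thesis ..
qed

end

theorem theorem8:
  fixes \<Delta> I :: "real set" and p :: nat and ns :: "nat \<Rightarrow> nat"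
    and w :: "nat \<Rightarrow> real \<Rightarrow> real" and s :: real and M :: "real measure" and lam :: real
  assumes "perfect_pair \<Delta> I p ns w s M"
    and "\<And>n m. 0 \<le> jacobi_matrix p ns w s M n m"
    and "abs_bound (zeros_B p ns w s M) < \<infinity>"
    and "complex_of_real (real_of_ereal (abs_bound (zeros_B p ns w s M))) \<notin> zeros_B p ns w s M"
    and "abs_bound (zeros_Q I p ns w s M) < \<infinity>"
    and "real_of_ereal (abs_bound (zeros_Q I p ns w s M)) \<notin> zeros_Q I p ns w s M"
    and "\<And>n. filterlim (typeI_form p ns w s M n) at_top at_top"
    and "lam \<in> I"
    and "max (abs_bound (zeros_B p ns w s M)) (abs_bound (zeros_Q I p ns w s M)) \<le> ereal lam"
    and "irreducible_chain (P_II lam p ns w s M)"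
    and "irreducible_chain (P_I lam p ns w s M)"
  shows "(recurrent_chain (P_II lam p ns w s M) \<and> recurrent_chain (P_I lam p ns w s M)
            \<longleftrightarrow> \<not> markov_integral_converges (w 1) M lam)
       \<and> (markov_integral_converges (w 1) M lam
            \<longrightarrow> transient_chain (P_II lam p ns w s M) \<and> transient_chain (P_I lam p ns w s M))"
proof -
  interpret perfect_pair \<Delta> I p ns w s M by fact
  have zB: "complex_of_real x \<in> zeros_B p ns w s M" if "poly (B n) x = 0" for n x
  proof -
    have "poly (map_poly complex_of_real (B n)) (complex_of_real x) = complex_of_real (poly (B n) x)"
      by (simp add: poly_altdef coeff_map_poly degree_map_poly)
    then show ?thesis using that by (auto simp: zeros_B_def intro!: exI[of _ n])
  qed
  have nB: "poly (B n) x \<noteq> 0" if "lam \<le> x" for n x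
    using abs_bound_no_zero_beyond[of "zeros_B p ns w s M" lam x] assms(4,9) that zB by auto
  have nQ: "Q n x \<noteq> 0" if "lam \<le> x" for n x
    using abs_bound_no_zero_beyond[of "zeros_Q I p ns w s M" lam x] assms(6,9) that
      atLeast_subset_I[OF assms(8)] by (auto simp: zeros_Q_def)
  \<comment> \<open>A real zero \<open>x\<close> of \<open>B 1\<close> satisfies
    \<open>\<bar>x\<bar> \<le> lam\<close> and \<open>x < lam\<close>; with \<open>lam = 0\<close>
    the first would give \<open>x = 0\<close>, against the second.\<close>
  have lam: "0 < lam"
  proof -
    obtain x where x: "poly (B 1) x = 0" using ex_zero_B_1 by blast
    have "ereal \<bar>x\<bar> \<le> abs_bound (zeros_B p ns w s M)"
      using zB[OF x] unfolding abs_bound_def by (metis SUP_upper norm_of_real)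
    also have "\<dots> \<le> ereal lam" using assms(9) by simp
    finally have "\<bar>x\<bar> \<le> lam" by simp
    moreover have "x < lam" using nB[of x 1] x by force
    ultimately show ?thesis using nB[of x 1] x by (cases "lam = 0") auto
  qed
  have pB: "0 < poly (B n) lam" for n by (rule poly_B_pos[OF nB])
  have pQ: "0 < Q n lam" for n by (rule Q_pos[OF nQ assms(8,7)])
  have stII: "stochastic (P_II lam p ns w s M)"
    by (rule stochastic_P_II[OF assms(2) lam pB])
  have stI: "stochastic (P_I lam p ns w s M)"
    by (rule stochastic_P_I[OF assms(2) lam pQ])
  interpret II: stochastic_matrix "P_II lam p ns w s M" by unfold_locales (rule stII)
  interpret I: stochastic_matrix "P_I lam p ns w s M" by unfold_locales (rule stI)
  \<comment> \<open>For \<open>i = j = 0\<close> the diagonal factors cancel and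
    \<open>B 0 = 1\<close>, so both chains have the same return probabilities, namely the moments of
    \<open>x / lam\<close>.\<close>
  have "summable (\<lambda>n. II.step_prob n 0 0) \<longleftrightarrow> markov_integral_converges (w 1) M lam"
    by (rule summable_return_iff[OF lam _ II.step_prob_bounds])
      (use pB[of 0] in \<open>simp add: step_prob_P_II[OF stII lam pB] B_0\<close>)
  moreover have "summable (\<lambda>n. I.step_prob n 0 0) \<longleftrightarrow> markov_integral_converges (w 1) M lam"
    by (rule summable_return_iff[OF lam _ I.step_prob_bounds])
      (use pQ[of 0] in \<open>simp add: step_prob_P_I[OF stI lam pQ] B_0\<close>)
  ultimately show ?thesis
    unfolding II.recurrent_chain_iff[OF assms(10), of 0] I.recurrent_chain_iff[OF assms(11), of 0]
      II.transient_chain_iff[OF assms(10), of 0] I.transient_chain_iff[OF assms(11), of 0]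
    by blast
qed

end
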